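(* Let $d\ge3$, $\phi>0$, $\epsilon\in(0,1]$, and let $\Sigma$ be a $d\times d$ symmetric positive definite matrix with unit diagonal entries; let $\sigma_*>0$ be the square root of the smallest eigenvalue of $\Sigma$. Let $v\in\mathbb Z$ and $K\in\mathbb R$ be such that $v\ge1$ and $K>0$. Set $\eta=\eta_d=K/\sqrt{\log d}$. Then $$\sup_{A\in\mathcal R}\sup_{w\in\mathbb R^d}\sum_{j_1,\dots,j_v=1}^d\ \sup_{y\in R(0,\epsilon\sigma_*\eta)}|\partial_{j_1,\dots, j_v}\rho^{A,\phi,\epsilon,\Sigma} (w+y)| \leq C\frac{(\log d)^{v/2}}{(\epsilon\sigma_* )^{v}},$$ where $C>0$ is a constant depending only on $v$ and $K$.
   Context: $\mathcal R$ is the class of rectangles $A=\prod_{j=1}^d(a_j,b_j]$ in $\mathbb R^d$ with $-\infty\le a_j\le b_j\le\infty$. $R(0,t):=\{y\in\mathbb R^d:\|y\|_\infty\le t\}$, with $\|y\|_\infty=\max_j|y_j|$. $\partial_{j_1,\dots,j_v}$ denotes the $v$-th order partial derivative with respect to coordinates $j_1,\dots,j_v$. The function $g^\phi:\mathbb R\to\mathbb R$ is given by $g^\phi(t)=1$ for $t\le0$, $g^\phi(t)=1-\phi t$ for $0<t<1/\phi$, and $g^\phi(t)=0$ for $t\ge1/\phi$. For $A=\prod_{j=1}^d(a_j,b_j]\in\mathcal R$, $$m^{A,\phi}(w):=g^\phi\Big(\max_{1\le j\le d}[(w_j-b_j)\vee(a_j-w_j)]\Big),\qquad \rho^{A,\phi,\epsilon,\Sigma}(w):=\mathrm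 E\, m^{A,\phi}(w+\epsilon Z),\quad w\in\mathbb R^d,$$ where $Z\sim N(0,\Sigma)$ in $\mathbb R^d$. *)

theory Defs
  imports
    "HOL-Probability.Probability"
    "Jordan_Normal_Form.Spectral_Radius"
    "Jordan_Normal_Form.Gauss_Jordan_Elimination"
begin

text \<open>
  The dimension \<open>d\<close> has to be quantified inside the statement, since the constant must not
  depend on it.  Points of $d$-dimensional space are therefore elements of \<^term>\<open>carrier_vec d\<close>,
  with coordinates indexed by \<open>0, \<dots>, d - 1\<close>.
\<close>

definition positive_definite :: "nat \<Rightarrow> real mat \<Rightarrow> bool" where
  "positive_definite d S \<longleftrightarrow>
     (\<forall>x \<in> carrier_vec d. x \<noteq> 0\<^sub>v d \<longrightarrow> scalar_prod x (S *\<^sub>v x) > 0)"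

definition sigma_star :: "real mat \<Rightarrow> real" where
  "sigma_star S = sqrt (Min (spectrum S))"

text \<open>
  The law $N(0,\Sigma)$ for a positive definite \<open>S\<close>, via its density with respect to
  \<open>d\<close>-dimensional Lebesgue measure.  As \<^typ>\<open>real vec\<close> carries no measurable structure, this is
  a measure on coordinate functions; use \<^term>\<open>vec d\<close> to turn an outcome into a vector.
\<close>

definition normal_law :: "nat \<Rightarrow> real mat \<Rightarrow> (nat \<Rightarrow> real) measure" where
  "normal_law d S = density (Pi\<^sub>M {..<d} (\<lambda>_. lborel))
     (\<lambda>z. ennreal (exp (- scalar_prod (vec d z) (the (mat_inverse S) *\<^sub>v vec d z) / 2)
                   / sqrt ((2 * pi) ^ d * Determinant.det S)))"

text \<open>
  A rectangle is given by its pair of endpoint families.  This matters only for the empty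
  rectangle, which has many such pairs: the smoothed indicator below depends on the endpoints,
  not just on the set, so suprema over rectangles range over all admissible pairs.
\<close>

definition rectangles :: "nat \<Rightarrow> ((nat \<Rightarrow> ereal) \<times> (nat \<Rightarrow> ereal)) set" where
  "rectangles d = {(a, b). \<forall>j<d. a j \<le> b j}"

definition g_fun :: "real \<Rightarrow> real \<Rightarrow> real" where
  "g_fun \<phi> t = (if t \<le> 0 then 1 else if t < 1 / \<phi> then 1 - \<phi> * t else 0)"

text \<open>Infinite endpoints can make the argument of \<^const>\<open>g_fun\<close> infinite; the values there are
  its limits.\<close>

definition g_ext :: "real \<Rightarrow> ereal \<Rightarrow> real" where
  "g_ext \<phi> t = (if t = -\<infinity> then 1 else if t = \<infinity> then 0 else g_fun \<phi> (real_of_ereal t))"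

definition m_fun :: "nat \<Rightarrow> (nat \<Rightarrow> ereal) \<times> (nat \<Rightarrow> ereal) \<Rightarrow> real \<Rightarrow> real vec \<Rightarrow> real" where
  "m_fun d A \<phi> w = (case A of (a, b) \<Rightarrow>
     g_ext \<phi> (Max ((\<lambda>j. max (ereal (vec_index w j) - b j) (a j - ereal (vec_index w j))) ` {..<d})))"

definition rho_fun ::
    "nat \<Rightarrow> (nat \<Rightarrow> ereal) \<times> (nat \<Rightarrow> ereal) \<Rightarrow> real \<Rightarrow> real \<Rightarrow> real mat \<Rightarrow> real vec \<Rightarrow> real" where
  "rho_fun d A \<phi> \<epsilon> S w = (\<integral>z. m_fun d A \<phi> (w + \<epsilon> \<cdot>\<^sub>v vec d z) \<partial>(normal_law d S))"

definition partial_deriv :: "nat \<Rightarrow> nat \<Rightarrow> (real vec \<Rightarrow> real) \<Rightarrow> real vec \<Rightarrow> real" where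
  "partial_deriv d j f w = deriv (\<lambda>h. f (w + h \<cdot>\<^sub>v unit_vec d j)) 0"

definition partial_derivs :: "nat \<Rightarrow> nat list \<Rightarrow> (real vec \<Rightarrow> real) \<Rightarrow> real vec \<Rightarrow> real" where
  "partial_derivs d js f = foldr (partial_deriv d) js f"

definition index_tuples :: "nat \<Rightarrow> nat \<Rightarrow> nat list set" where
  "index_tuples d v = {js. length js = v \<and> set js \<subseteq> {..<d}}"

definition sup_norm :: "nat \<Rightarrow> real vec \<Rightarrow> real" where
  "sup_norm d y = Max ((\<lambda>j. \<bar>vec_index y j\<bar>) ` {..<d})"

definition R_box :: "nat \<Rightarrow> real \<Rightarrow> real vec set" where
  "R_box d t = {y \<in> carrier_vec d. sup_norm d y \<le> t}"

end

theory Submission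
  imports Defs
begin

text \<open>
  The function \<open>rho_fun\<close> is an average of products of one-dimensional functions, and for such
  products the sum of the derivatives is bounded by comparing each differentiated factor with the
  normal tail that the same factor leaves out.

  Let \<open>s\<close> be half of \<open>sigma_star S\<close>.  The matrix \<open>S - s\<^sup>2 I\<close> is positive definite,
  so \<open>N(0, S)\<close> is a mixture of the laws \<open>N(x, s\<^sup>2 I)\<close> over centres \<open>x\<close> whose law has a density
  (\<open>gaussian_density_mixture\<close>).  The function \<open>m_fun\<close> is in turn the average, over levels
  \<open>u\<close> in the unit interval, of the indicators of the open rectangles that arise from the given one by
  moving every face outwards by \<open>u / \<phi>\<close> (\<open>m_fun_eq_nn_integral\<close>).  Hence \<open>rho_fun\<close> is an
  average over pairs \<open>(x, u)\<close> of products over the coordinates, where the factor \<open>j\<close> is the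
  probability that a normal variable of standard deviation \<open>h = \<epsilon> s\<close> falls into an
  interval (\<open>rho_fun_mixture\<close>).  A partial derivative differentiates the factor \<open>j\<close> as often as
  \<open>j\<close> occurs among the indices (\<open>partial_derivs_integral_prod\<close>).

  Fix \<open>(x, u)\<close>, let \<open>L = sqrt (ln d)\<close>, and let \<open>\<theta> j\<close> be a lower bound, valid on the whole
  box, for the probability that coordinate \<open>j\<close> misses its interval (\<open>outside_mass\<close>).  A factor that is not
  differentiated is at most \<open>1 - \<theta> j\<close>, hence at most \<open>exp (- \<theta> j)\<close>.  The \<open>r\<close>-th derivative
  of a factor, at \<open>t\<close> standard deviations from an end of the interval, is of the order of
  \<open>h\<^sup>-\<^sup>r (1 + t)\<^sup>r\<^sup>-\<^sup>1\<close> times the normal density at \<open>t\<close>, and the density is at most of the order of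
  \<open>1 + t\<close> times the tail.  So for \<open>t \<le> 2 L\<close> the derivative is of the order of \<open>(L / h)\<^sup>r\<close> times
  the tail, and for such \<open>t\<close> a move by a multiple of \<open>1 / L\<close> changes the tail by a bounded factor only;
  this is why the box may have a side of that order.  For \<open>t > 2 L\<close> the derivative is so small that a
  multiple of \<open>(L / h)\<^sup>r exp (- L\<^sup>2) = (L / h)\<^sup>r / d\<close> bounds it.  Altogether a factor
  differentiated \<open>r\<close> times is at most a constant times \<open>(L / h)\<^sup>r (\<theta> j + 1 / d)\<close>
  (\<open>interval_deriv_le_outside_mass\<close>).

  It remains to sum the products of the numbers \<open>\<theta> j + 1 / d\<close> over the distinct indices \<open>j\<close> of
  a tuple.  With \<open>\<Theta>\<close> the sum of all \<open>\<theta> j\<close>, the total over all tuples is at most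
  \<open>(v + 1 + \<Theta>)\<^sup>v\<close> (\<open>sum_index_tuples_prod_set_le\<close>); the summands \<open>1 / d\<close> only contribute the \<open>1\<close>.
  The other factors contribute \<open>exp (- \<Theta>)\<close>, up to a constant, and
  \<open>exp (- \<Theta>) (v + 1 + \<Theta>)\<^sup>v\<close> is bounded in terms of \<open>v\<close> alone.  This bound is uniform in \<open>(x, u)\<close>, so it
  survives the averaging.
\<close>

section \<open>Quadratic forms and Gaussian integrals\<close>

text \<open>
  Quadratic forms are taken on coordinate functions, the points over which \<open>normal_law\<close>
  integrates, so that integrating out one coordinate is a function update.
\<close>

definition qform :: "nat \<Rightarrow> real mat \<Rightarrow> (nat \<Rightarrow> real) \<Rightarrow> real" where
  "qform n P z = (\<Sum>i<n. \<Sum>j<n. P $$ (i, j) * z i * z j)"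

lemma scalar_prod_mult_mat_vec_eq_qform:
  assumes "P \<in> carrier_mat n n"
  shows "scalar_prod (vec n z) (P *\<^sub>v vec n z) = qform n P z"
  using assms
  by (auto simp: qform_def scalar_prod_def atLeast0LessThan sum_distrib_left mult_ac intro!: sum.cong)

lemma qform_cong: "(\<And>i. i < n \<Longrightarrow> z i = z' i) \<Longrightarrow> qform n P z = qform n P z'"
  by (auto simp: qform_def intro!: sum.cong)

lemma positive_definite_iff_qform:
  assumes P: "P \<in> carrier_mat n n"
  shows "positive_definite n P \<longleftrightarrow> (\<forall>z. (\<exists>i<n. z i \<noteq> 0) \<longrightarrow> qform n P z > 0)"
proof
  assume pd: "positive_definite n P"
  show "\<forall>z. (\<exists>i<n. z i \<noteq> 0) \<longrightarrow> qform n P z > 0"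
  proof (intro allI impI)
    fix z :: "nat \<Rightarrow> real"
    assume "\<exists>i<n. z i \<noteq> 0"
    then have "vec n z \<noteq> 0\<^sub>v n"
      by (metis index_vec index_zero_vec(1))
    then show "qform n P z > 0"
      using pd scalar_prod_mult_mat_vec_eq_qform[OF P, of z] unfolding positive_definite_def by auto
  qed
next
  assume *: "\<forall>z. (\<exists>i<n. z i \<noteq> 0) \<longrightarrow> qform n P z > 0"
  show "positive_definite n P"
    unfolding positive_definite_def
  proof (intro ballI impI)
    fix x :: "real vec"
    assume x: "x \<in> carrier_vec n" "x \<noteq> 0\<^sub>v n"
    then have eq: "x = vec n (vec_index x)" by auto
    have "\<exists>i<n. vec_index x i \<noteq> 0"
      using x by (metis carrier_vecD eq_vecI index_zero_vec)
    then show "x \<bullet> (P *\<^sub>v x) > 0"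
      using * scalar_prod_mult_mat_vec_eq_qform[OF P, of "vec_index x"] eq by simp
  qed
qed

definition schur_complement :: "nat \<Rightarrow> real mat \<Rightarrow> real mat" where
  "schur_complement n P = mat n n (\<lambda>(i, j). P $$ (i, j) - P $$ (i, n) * P $$ (n, j) / P $$ (n, n))"

text \<open>
  Right multiplication by a unipotent lower triangular matrix clears the last row up to its last
  entry.
\<close>

lemma det_schur_complement:
  assumes P: "P \<in> carrier_mat (Suc n) (Suc n)" and a: "P $$ (n, n) \<noteq> 0"
  shows "Determinant.det P = P $$ (n, n) * Determinant.det (schur_complement n P)"
proof -
  define A where "A = mat n n (\<lambda>(i, j). P $$ (i, j))"
  define b where "b = mat n 1 (\<lambda>(i, j). P $$ (i, n))"
  define c where "c = mat 1 n (\<lambda>(i, j). P $$ (n, j))"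
  define D where "D = mat 1 1 (\<lambda>(i, j). P $$ (n, n))"
  define q where "q = mat 1 n (\<lambda>(i, j). - P $$ (n, j) / P $$ (n, n))"
  define E where "E = four_block_mat (1\<^sub>m n) (0\<^sub>m n 1) q (1\<^sub>m 1)"
  have carr: "A \<in> carrier_mat n n" "b \<in> carrier_mat n 1" "c \<in> carrier_mat 1 n" "D \<in> carrier_mat 1 1"
    "q \<in> carrier_mat 1 n"
    by (auto simp: A_def b_def c_def D_def q_def)
  have Pb: "P = four_block_mat A b c D"
    by (rule eq_matI) (use P in \<open>auto simp: four_block_mat_def A_def b_def c_def D_def less_Suc_eq\<close>)
  have "P * E = four_block_mat (A * 1\<^sub>m n + b * q) (A * 0\<^sub>m n 1 + b * 1\<^sub>m 1)
      (c * 1\<^sub>m n + D * q) (c * 0\<^sub>m n 1 + D * 1\<^sub>m 1)"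
    unfolding Pb E_def by (rule mult_four_block_mat) (use carr in auto)
  also have "A * 1\<^sub>m n + b * q = schur_complement n P"
    using carr by (intro eq_matI)
      (auto simp: schur_complement_def A_def b_def q_def scalar_prod_def)
  also have "A * 0\<^sub>m n 1 + b * 1\<^sub>m 1 = b"
    using carr by (intro eq_matI) (auto simp: scalar_prod_def A_def b_def)
  also have "c * 1\<^sub>m n + D * q = 0\<^sub>m 1 n"
    using carr a by (intro eq_matI) (auto simp: c_def D_def q_def scalar_prod_def)
  also have "c * 0\<^sub>m n 1 + D * 1\<^sub>m 1 = D"
    using carr by (intro eq_matI) (auto simp: scalar_prod_def D_def)
  finally have PE: "P * E = four_block_mat (schur_complement n P) b (0\<^sub>m 1 n) D" .
  have "Determinant.det (P * E) = Determinant.det (schur_complement n P) * Determinant.det D"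
    unfolding PE
    by (rule det_four_block_mat_lower_left_zero)
      (use carr in \<open>auto simp: schur_complement_def\<close>)
  moreover have "Determinant.det (P * E) = Determinant.det P * Determinant.det E"
    by (rule det_mult[OF P]) (use carr in \<open>auto simp: E_def\<close>)
  moreover have "Determinant.det E = Determinant.det (1\<^sub>m n) * Determinant.det (1\<^sub>m 1 :: real mat)"
    unfolding E_def
    by (rule det_four_block_mat_upper_right_zero) (use carr in auto)
  moreover have "Determinant.det D = P $$ (n, n)"
    using carr by (simp add: D_def det_single)
  ultimately show ?thesis by simp
qed

text \<open>
  Completing the square in the last variable separates it from the others, at the price of a
  translation that Lebesgue measure does not see.
\<close>

lemma qform_Suc_schur_complement:
  assumes sym: "\<And>i j. i \<le> n \<Longrightarrow> j \<le> n \<Longrightarrow> P $$ (i, j) = P $$ (j, i)" and a: "P $$ (n, n) \<noteq> 0"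
  shows "qform (Suc n) P z = P $$ (n, n) * (z n + (\<Sum>i<n. P $$ (n, i) * z i) / P $$ (n, n))\<^sup>2
           + qform n (schur_complement n P) z"
proof -
  define a' where "a' = P $$ (n, n)"
  define s where "s = (\<Sum>i<n. P $$ (n, i) * z i)"
  have s2: "s * s = (\<Sum>i<n. \<Sum>j<n. P $$ (i, n) * P $$ (n, j) * z i * z j)"
    unfolding s_def sum_product by (intro sum.cong refl) (use sym in \<open>auto simp: mult_ac\<close>)
  have "qform n (schur_complement n P) z
      = (\<Sum>i<n. \<Sum>j<n. P $$ (i, j) * z i * z j - (P $$ (i, n) * P $$ (n, j) * z i * z j) / a')"
    unfolding qform_def schur_complement_def a'_def
    by (intro sum.cong refl) (auto simp: algebra_simps divide_simps)
  also have "\<dots> = qform n P z - s * s / a'"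
    by (simp add: sum_subtractf s2 qform_def sum_divide_distrib)
  finally have 1: "qform n (schur_complement n P) z = qform n P z - s * s / a'" .
  have "(\<Sum>i<n. P $$ (i, n) * z i * z n) = s * z n"
    unfolding s_def sum_distrib_right by (intro sum.cong refl) (use sym in auto)
  moreover have "(\<Sum>j<n. P $$ (n, j) * z n * z j) = s * z n"
    unfolding s_def sum_distrib_right by (intro sum.cong refl) auto
  ultimately have 2: "qform (Suc n) P z = qform n P z + 2 * s * z n + a' * z n * z n"
    by (simp add: qform_def sum.distrib a'_def)
  have "a' \<noteq> 0" using a by (simp add: a'_def)
  then show ?thesis
    unfolding 1 2 a'_def[symmetric] s_def[symmetric]
    by (simp add: field_simps power2_eq_square)
qed

lemma nn_integral_normal_density:
  "s > 0 \<Longrightarrow> (\<integral>\<^sup>+y. ennreal (normal_density m s y) \<partial>lborel) = 1"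
  using integral_normal_density[of s m] integrable_normal_density[of s m]
  by (subst nn_integral_eq_integral) (auto simp: normal_density_nonneg)

lemma nn_integral_exp_quadratic:
  fixes a c :: real
  assumes "a > 0"
  shows "(\<integral>\<^sup>+y. ennreal (exp (- (a * (y + c)\<^sup>2) / 2)) \<partial>lborel) = ennreal (sqrt (2 * pi / a))"
proof -
  have s: "1 / sqrt a > 0" using assms by simp
  have *: "exp (- (a * (y + c)\<^sup>2) / 2) = sqrt (2 * pi / a) * normal_density (- c) (1 / sqrt a) y" for y
    using assms by (simp add: normal_density_def real_sqrt_divide real_sqrt_mult power_divide field_simps)
  show ?thesis
    unfolding * using assms
    by (simp add: ennreal_mult' nn_integral_cmult nn_integral_normal_density[OF s] normal_density_nonneg)
qed

lemma measurable_qform [measurable]: "qform n P \<in> borel_measurable (Pi\<^sub>M {..<n} (\<lambda>_. lborel))"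
  unfolding qform_def by measurable

text \<open>
  Induction on the dimension.  By completing the square, integrating out the last coordinate
  gives the factor \<open>sqrt (2 * pi / a)\<close> with \<open>a\<close> the last diagonal entry, and leaves the Gaussian
  integral of the Schur complement, whose determinant is \<open>det P / a\<close>.  The Schur complement
  is again positive definite because its form at \<open>z\<close> is the minimum of the original one over the last
  coordinate.
\<close>

lemma gaussian_mass:
  assumes "P \<in> carrier_mat n n" "transpose_mat P = P" "positive_definite n P"
  shows "Determinant.det P > 0"
    and "(\<integral>\<^sup>+z. ennreal (exp (- qform n P z / 2)) \<partial>Pi\<^sub>M {..<n} (\<lambda>_. lborel))
           = ennreal (sqrt ((2 * pi) ^ n / Determinant.det P))"
proof -
  have "Determinant.det P > 0 \<and> (\<integral>\<^sup>+z. ennreal (exp (- qform n P z / 2)) \<partial>Pi\<^sub>M {..<n} (\<lambda>_. lborel))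
           = ennreal (sqrt ((2 * pi) ^ n / Determinant.det P))"
    using assms
  proof (induction n arbitrary: P)
    case 0
    interpret product_sigma_finite "\<lambda>_::nat. lborel :: real measure"
      by standard
    have "Determinant.det P = 1" using 0 by simp
    then show ?case
      by (simp add: qform_def PiM_empty)
  next
    case (Suc n)
    interpret product_sigma_finite "\<lambda>_::nat. lborel :: real measure"
      by standard
    let ?Q = "schur_complement n P"
    let ?a = "P $$ (n, n)"
    have sym: "P $$ (i, j) = P $$ (j, i)" if "i \<le> n" "j \<le> n" for i j
    proof -
      have "transpose_mat P $$ (i, j) = P $$ (j, i)"
        using that Suc.prems(1) by (intro index_transpose_mat) auto
      then show ?thesis using Suc.prems(2) by simp
    qed
    have pd: "qform (Suc n) P z > 0" if "\<exists>i<Suc n. z i \<noteq> 0" for z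
      using that Suc.prems(3) positive_definite_iff_qform[OF Suc.prems(1)] by blast
    have "qform (Suc n) P (\<lambda>i. if i = n then 1 else 0) = ?a"
    proof -
      have "qform (Suc n) P (\<lambda>i. if i = n then 1 else 0)
          = (\<Sum>i<Suc n. \<Sum>j<Suc n. if j = n then (if i = n then P $$ (i, j) else 0) else 0)"
        unfolding qform_def by (intro sum.cong refl) auto
      also have "\<dots> = ?a"
        by (simp add: sum.delta del: sum.lessThan_Suc)
      finally show ?thesis .
    qed
    with pd[of "\<lambda>i. if i = n then 1 else 0"] have a: "?a > 0"
      by auto
    have qf: "qform (Suc n) P z = ?a * (z n + (\<Sum>i<n. P $$ (n, i) * z i) / ?a)\<^sup>2 + qform n ?Q z" for z
      by (rule qform_Suc_schur_complement) (use sym a in auto)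
    have Qc: "?Q \<in> carrier_mat n n" by (simp add: schur_complement_def)
    have Qsym: "transpose_mat ?Q = ?Q"
      using sym by (intro eq_matI) (auto simp: schur_complement_def)
    have Qpd: "positive_definite n ?Q"
      unfolding positive_definite_iff_qform[OF Qc]
    proof (intro allI impI)
      fix z :: "nat \<Rightarrow> real"
      assume z: "\<exists>i<n. z i \<noteq> 0"
      \<comment> \<open>the last coordinate that makes the completed square vanish\<close>
      define z' where "z' = z(n := - (\<Sum>i<n. P $$ (n, i) * z i) / ?a)"
      have "qform (Suc n) P z' = qform n ?Q z'"
        unfolding qf by (simp add: z'_def)
      also have "\<dots> = qform n ?Q z"
        by (rule qform_cong) (auto simp: z'_def)
      finally have "qform (Suc n) P z' = qform n ?Q z" .
      moreover have "\<exists>i<Suc n. z' i \<noteq> 0"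
        using z by (metis fun_upd_other less_SucI less_irrefl z'_def)
      ultimately show "qform n ?Q z > 0"
        using pd[of z'] by simp
    qed
    note IH = Suc.IH[OF Qc Qsym Qpd]
    have det: "Determinant.det P = ?a * Determinant.det ?Q"
      using a by (intro det_schur_complement Suc.prems) auto
    have "(\<integral>\<^sup>+z. ennreal (exp (- qform (Suc n) P z / 2)) \<partial>Pi\<^sub>M {..<Suc n} (\<lambda>_. lborel))
      = (\<integral>\<^sup>+z. (\<integral>\<^sup>+y. ennreal (exp (- qform (Suc n) P (z(n := y)) / 2)) \<partial>lborel) \<partial>Pi\<^sub>M {..<n} (\<lambda>_. lborel))"
      unfolding lessThan_Suc
      by (rule product_nn_integral_insert) (auto simp: lessThan_Suc[symmetric])
    also have "\<dots> = (\<integral>\<^sup>+z. ennreal (sqrt (2 * pi / ?a)) * ennreal (exp (- qform n ?Q z / 2)) \<partial>Pi\<^sub>M {..<n} (\<lambda>_. lborel))"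
    proof (rule nn_integral_cong)
      fix z :: "nat \<Rightarrow> real"
      let ?c = "(\<Sum>i<n. P $$ (n, i) * z i) / ?a"
      have "qform (Suc n) P (z(n := y)) = ?a * (y + ?c)\<^sup>2 + qform n ?Q z" for y
        unfolding qf by (simp add: qform_def)
      then have "ennreal (exp (- qform (Suc n) P (z(n := y)) / 2))
          = ennreal (exp (- qform n ?Q z / 2)) * ennreal (exp (- (?a * (y + ?c)\<^sup>2) / 2))" for y
        by (simp add: ennreal_mult'[symmetric] exp_add[symmetric] field_simps)
      then have "(\<integral>\<^sup>+y. ennreal (exp (- qform (Suc n) P (z(n := y)) / 2)) \<partial>lborel)
          = ennreal (exp (- qform n ?Q z / 2)) * (\<integral>\<^sup>+y. ennreal (exp (- (?a * (y + ?c)\<^sup>2) / 2)) \<partial>lborel)"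
        by (simp only:) (intro nn_integral_cmult, measurable)
      then show "(\<integral>\<^sup>+y. ennreal (exp (- qform (Suc n) P (z(n := y)) / 2)) \<partial>lborel)
          = ennreal (sqrt (2 * pi / ?a)) * ennreal (exp (- qform n ?Q z / 2))"
        by (simp only: nn_integral_exp_quadratic[OF a] mult.commute)
    qed
    also have "\<dots> = ennreal (sqrt (2 * pi / ?a)) * ennreal (sqrt ((2 * pi) ^ n / Determinant.det ?Q))"
      using IH by (simp add: nn_integral_cmult)
    also have "\<dots> = ennreal (sqrt ((2 * pi) ^ Suc n / Determinant.det P))"
      using a IH by (simp add: det ennreal_mult'[symmetric] real_sqrt_mult[symmetric] del: ennreal_mult'')
    finally show ?case using det a IH by simp
  qed
  then show "Determinant.det P > 0"
    and "(\<integral>\<^sup>+z. ennreal (exp (- qform n P z / 2)) \<partial>Pi\<^sub>M {..<n} (\<lambda>_. lborel))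
           = ennreal (sqrt ((2 * pi) ^ n / Determinant.det P))" by auto
qed

lemma nn_integral_PiM_translate:
  fixes c :: "nat \<Rightarrow> real"
  assumes f: "f \<in> borel_measurable (Pi\<^sub>M {..<n} (\<lambda>_. lborel))"
  shows "(\<integral>\<^sup>+x. f (\<lambda>i\<in>{..<n}. x i - c i) \<partial>Pi\<^sub>M {..<n} (\<lambda>_. lborel)) = (\<integral>\<^sup>+x. f x \<partial>Pi\<^sub>M {..<n} (\<lambda>_. lborel))"
proof -
  let ?M = "Pi\<^sub>M {..<n} (\<lambda>_. lborel :: real measure)"
  let ?T = "\<lambda>x. \<lambda>i\<in>{..<n}. x i - c i"
  interpret product_sigma_finite "\<lambda>_::nat. lborel :: real measure"
    by standard
  have T: "?T \<in> measurable ?M ?M"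
    by measurable
  have "distr ?M ?M ?T = ?M"
  proof (rule PiM_eqI)
    fix A :: "nat \<Rightarrow> real set"
    assume A: "\<And>i. i \<in> {..<n} \<Longrightarrow> A i \<in> sets lborel"
    have shift: "(\<lambda>y. y - c i) -` A i \<in> sets borel" if "i < n" for i
      using measurable_sets[of "\<lambda>y. y - c i" borel borel "A i"] A that by simp
    have "?T -` (PiE {..<n} A) \<inter> space ?M = PiE {..<n} (\<lambda>i. (\<lambda>y. y - c i) -` A i)"
      by (auto simp: space_PiM PiE_iff extensional_def)
    then have "emeasure (distr ?M ?M ?T) (PiE {..<n} A) = emeasure ?M (PiE {..<n} (\<lambda>i. (\<lambda>y. y - c i) -` A i))"
      using A T by (subst emeasure_distr) (auto intro!: sets_PiM_I_finite)
    also have "\<dots> = (\<Prod>i<n. emeasure lborel ((\<lambda>y. y - c i) -` A i))"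
      using shift by (intro emeasure_PiM) auto
    also have "\<dots> = (\<Prod>i<n. emeasure lborel (A i))"
    proof (intro prod.cong refl)
      fix i assume "i \<in> {..<n}"
      have "emeasure lborel (A i) = emeasure (distr lborel borel ((+) (- c i))) (A i)"
        by (simp add: lborel_distr_plus)
      also have "\<dots> = emeasure lborel ((+) (- c i) -` A i)"
        using A \<open>i \<in> {..<n}\<close> by (subst emeasure_distr) auto
      also have "(+) (- c i) = (\<lambda>y. y - c i)" by auto
      finally show "emeasure lborel ((\<lambda>y. y - c i) -` A i) = emeasure lborel (A i)" by simp
    qed
    finally show "emeasure (distr ?M ?M ?T) (PiE {..<n} A) = (\<Prod>i\<in>{..<n}. emeasure lborel (A i))" .
  qed auto
  then have "(\<integral>\<^sup>+x. f x \<partial>?M) = (\<integral>\<^sup>+x. f x \<partial>distr ?M ?M ?T)" by simp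
  also have "\<dots> = (\<integral>\<^sup>+x. f (?T x) \<partial>?M)"
    using T f by (intro nn_integral_distr) auto
  finally show ?thesis by simp
qed

section \<open>The smallest eigenvalue of a symmetric matrix\<close>

definition mat_apply :: "nat \<Rightarrow> real mat \<Rightarrow> (nat \<Rightarrow> real) \<Rightarrow> nat \<Rightarrow> real" where
  "mat_apply n P z i = (\<Sum>j<n. P $$ (i, j) * z j)"

lemma vec_mat_apply:
  assumes "P \<in> carrier_mat n n"
  shows "P *\<^sub>v vec n z = vec n (mat_apply n P z)"
  using assms by (intro eq_vecI) (auto simp: mat_apply_def scalar_prod_def atLeast0LessThan)

lemma qform_eq_sum_mat_apply: "qform n P z = (\<Sum>i<n. z i * mat_apply n P z i)"
  by (simp add: qform_def mat_apply_def sum_distrib_left mult_ac)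

lemma symmetric_mat_entries:
  assumes "P \<in> carrier_mat n n" "transpose_mat P = P" "i < n" "j < n"
  shows "P $$ (i, j) = P $$ (j, i)"
  using assms by (metis carrier_matD(1) carrier_matD(2) index_transpose_mat(1))

lemma sum_mat_apply_symmetric:
  assumes "P \<in> carrier_mat n n" "transpose_mat P = P"
  shows "(\<Sum>i<n. x i * mat_apply n P y i) = (\<Sum>i<n. y i * mat_apply n P x i)"
proof -
  have "(\<Sum>i<n. x i * mat_apply n P y i) = (\<Sum>i<n. \<Sum>j<n. x i * P $$ (i, j) * y j)"
    by (simp add: mat_apply_def sum_distrib_left mult_ac)
  also have "\<dots> = (\<Sum>j<n. \<Sum>i<n. x i * P $$ (i, j) * y j)"
    by (rule sum.swap)
  also have "\<dots> = (\<Sum>j<n. y j * mat_apply n P x j)"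
    unfolding mat_apply_def sum_distrib_left
    by (intro sum.cong refl) (use symmetric_mat_entries[OF assms] in \<open>auto simp: mult_ac\<close>)
  finally show ?thesis .
qed

lemma qform_add_scaled:
  assumes "P \<in> carrier_mat n n" "transpose_mat P = P"
  shows "qform n P (\<lambda>i. x i + t * u i)
    = qform n P x + 2 * t * (\<Sum>i<n. u i * mat_apply n P x i) + t\<^sup>2 * qform n P u"
proof -
  have lin: "mat_apply n P (\<lambda>i. x i + t * u i) i = mat_apply n P x i + t * mat_apply n P u i" for i
    by (simp add: mat_apply_def sum_distrib_left sum.distrib distrib_left mult_ac)
  have "qform n P (\<lambda>i. x i + t * u i)
      = qform n P x + t * (\<Sum>i<n. u i * mat_apply n P x i) + t * (\<Sum>i<n. x i * mat_apply n P u i)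
        + t\<^sup>2 * qform n P u"
    unfolding qform_eq_sum_mat_apply lin
    by (simp add: sum_distrib_left sum.distrib distrib_left distrib_right mult_ac power2_eq_square)
  then show ?thesis
    using sum_mat_apply_symmetric[OF assms, of x u] by simp
qed

text \<open>
  Requiring the coordinates from \<open>n\<close> on to vanish confines the sphere to a product of compact
  sets, which is compact by Tychonoff.
\<close>

lemma compact_unit_sphere_fun:
  "compact {z :: nat \<Rightarrow> real. (\<forall>i\<ge>n. z i = 0) \<and> (\<Sum>i<n. (z i)\<^sup>2) = 1}"
proof -
  let ?B = "PiE UNIV (\<lambda>i. if i < n then {-1..1} else {0}) :: (nat \<Rightarrow> real) set"
  have "compactin (product_topology (\<lambda>_. euclidean) UNIV) ?B"
    unfolding compactin_PiE by auto
  then have B: "compact ?B"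
    by (simp add: euclidean_product_topology)
  have "continuous_on UNIV (\<lambda>z :: nat \<Rightarrow> real. \<Sum>i<n. (z i)\<^sup>2)"
    by (intro continuous_intros continuous_on_product_coordinates)
  then have "closed ((\<lambda>z :: nat \<Rightarrow> real. \<Sum>i<n. (z i)\<^sup>2) -` {1})"
    by (intro closed_vimage) auto
  then have "compact (?B \<inter> (\<lambda>z :: nat \<Rightarrow> real. \<Sum>i<n. (z i)\<^sup>2) -` {1})"
    by (rule compact_Int_closed[OF B])
  also have "?B \<inter> (\<lambda>z :: nat \<Rightarrow> real. \<Sum>i<n. (z i)\<^sup>2) -` {1}
      = {z. (\<forall>i\<ge>n. z i = 0) \<and> (\<Sum>i<n. (z i)\<^sup>2) = 1}" (is "?L = ?R")
  proof (intro equalityI subsetI)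
    fix z assume z: "z \<in> ?L"
    have zi: "z i \<in> (if i < n then {-1..1} else {0})" for i
      by (rule PiE_mem[OF IntD1[OF z] UNIV_I])
    have "z i = 0" if "i \<ge> n" for i
      using zi[of i] that by simp
    then show "z \<in> ?R" using z by simp
  next
    fix z assume z: "z \<in> ?R"
    have "\<bar>z i\<bar> \<le> 1" if "i < n" for i
    proof -
      have "(z i)\<^sup>2 \<le> (\<Sum>i<n. (z i)\<^sup>2)"
        using that by (intro member_le_sum) auto
      with z show ?thesis by (simp add: abs_square_le_1)
    qed
    then have "z i \<in> (if i < n then {-1..1} else {0})" for i
      using z by (auto simp: abs_le_iff minus_le_iff)
    then show "z \<in> ?L" using z by (simp add: PiE_iff)
  qed
  finally show ?thesis .
qed

text \<open>
  The form attains its minimum \<open>l\<close> on the unit sphere, at \<open>x\<close> say.  The form minus \<open>l\<close> times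
  the squared norm is then nonnegative and vanishes at \<open>x\<close>, so its gradient vanishes there too; that is,
  \<open>x\<close> is an eigenvector with eigenvalue \<open>l\<close>.  So \<open>Min (spectrum S) \<le> l\<close>, and \<open>l\<close> bounds the Rayleigh
  quotient from below.
\<close>

lemma Min_spectrum_le_qform:
  assumes S: "S \<in> carrier_mat n n" "transpose_mat S = S" and n: "n > 0"
  shows "spectrum S \<noteq> {}" and "Min (spectrum S) * (\<Sum>i<n. (z i)\<^sup>2) \<le> qform n S z"
proof -
  define K where "K = {z :: nat \<Rightarrow> real. (\<forall>i\<ge>n. z i = 0) \<and> (\<Sum>i<n. (z i)\<^sup>2) = 1}"
  have K_iff: "z \<in> K \<longleftrightarrow> (\<forall>i\<ge>n. z i = 0) \<and> (\<Sum>i<n. (z i)\<^sup>2) = 1" for z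
    by (simp add: K_def)
  have K: "compact K" unfolding K_def by (rule compact_unit_sphere_fun)
  have "(\<Sum>i<n. ((if i = 0 then 1 else 0) :: real)\<^sup>2) = (\<Sum>i<n. if i = 0 then 1 else 0)"
    by (intro sum.cong refl) auto
  then have "(\<lambda>i. if i = 0 then 1 else 0) \<in> K"
    unfolding K_iff using n by simp
  then have ne: "K \<noteq> {}" by blast
  have cont: "continuous_on K (qform n S)"
    unfolding qform_def
    by (intro continuous_on_sum continuous_on_mult continuous_on_const
        continuous_on_subset[OF continuous_on_product_coordinates] subset_UNIV)
  obtain x where x: "x \<in> K" and min: "\<And>y. y \<in> K \<Longrightarrow> qform n S x \<le> qform n S y"
    using continuous_attains_inf[OF K ne cont] by blast
  define l where "l = qform n S x"
  have ge: "l * (\<Sum>i<n. (z i)\<^sup>2) \<le> qform n S z" for z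
  proof (cases "(\<Sum>i<n. (z i)\<^sup>2) = 0")
    case True
    then have "z i = 0" if "i < n" for i
      using that by (auto simp: sum_nonneg_eq_0_iff)
    then have "qform n S z = 0" by (simp add: qform_def)
    with True show ?thesis by simp
  next
    case False
    define r where "r = (\<Sum>i<n. (z i)\<^sup>2)"
    have r: "r > 0" using False by (simp add: r_def sum_nonneg less_le)
    define y where "y = (\<lambda>i. if i < n then z i / sqrt r else 0)"
    have "(\<Sum>i<n. (y i)\<^sup>2) = (\<Sum>i<n. (z i)\<^sup>2 / r)"
      using r by (intro sum.cong refl) (auto simp: y_def power_divide)
    also have "\<dots> = 1" using r by (simp add: sum_divide_distrib[symmetric] r_def)
    finally have "y \<in> K" unfolding K_iff by (simp add: y_def)
    then have "l \<le> qform n S y" using min by (simp add: l_def)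
    also have "qform n S y = qform n S z / r"
      unfolding qform_def sum_divide_distrib using r
      by (intro sum.cong refl) (auto simp: y_def)
    finally show ?thesis using r by (simp add: field_simps r_def)
  qed
  define e where "e = (\<lambda>i. mat_apply n S x i - l * x i)"
  define b where "b = (\<Sum>i<n. (e i)\<^sup>2)"
  define c where "c = qform n S e - l * b"
  have xx: "(\<Sum>i<n. (x i)\<^sup>2) = 1" using x by (simp add: K_iff)
  \<comment> \<open>move from \<open>x\<close> along its own residual \<open>e\<close>; half the linear coefficient is the squared norm of \<open>e\<close>\<close>
  have quad: "0 \<le> 2 * t * b + t\<^sup>2 * c" for t
  proof -
    have 1: "(\<Sum>i<n. (x i + t * e i)\<^sup>2) = 1 + 2 * t * (\<Sum>i<n. e i * x i) + t\<^sup>2 * b"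
      unfolding xx[symmetric] b_def sum_distrib_left sum.distrib[symmetric]
      by (intro sum.cong refl) (auto simp: power2_eq_square algebra_simps)
    have "b = (\<Sum>i<n. e i * mat_apply n S x i) - l * (\<Sum>i<n. e i * x i)"
      unfolding b_def sum_distrib_left sum_subtractf[symmetric]
      by (intro sum.cong refl) (auto simp: power2_eq_square algebra_simps e_def)
    then have 2: "(\<Sum>i<n. e i * mat_apply n S x i) = b + l * (\<Sum>i<n. e i * x i)" by simp
    have "qform n S (\<lambda>i. x i + t * e i) - l * (\<Sum>i<n. (x i + t * e i)\<^sup>2)
        = 2 * t * b + t\<^sup>2 * c"
      unfolding qform_add_scaled[OF S] c_def l_def[symmetric] 1 2 by (simp add: algebra_simps)
    with ge[of "\<lambda>i. x i + t * e i"] show ?thesis by simp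
  qed
  have b0: "b \<ge> 0" by (simp add: b_def sum_nonneg)
  have "b = 0"
  proof (rule ccontr)
    assume "b \<noteq> 0"
    with b0 have b: "b > 0" by simp
    define k where "k = \<bar>c\<bar> + 1"
    \<comment> \<open>a step \<open>- r\<close> so short that the linear term dominates the quadratic one\<close>
    define r where "r = b / k"
    have k: "k > 0" "c - 2 * k < 0" by (auto simp: k_def)
    have r: "r > 0" "b = r * k" using b k by (auto simp: r_def)
    have "0 \<le> 2 * (- r) * b + (- r)\<^sup>2 * c" by (rule quad)
    also have "\<dots> = r\<^sup>2 * (c - 2 * k)"
      by (simp add: r(2) power2_eq_square algebra_simps)
    also have "\<dots> < 0"
      using r k by (intro mult_pos_neg) auto
    finally show False by simp
  qed
  then have e0: "e i = 0" if "i < n" for i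
    using that by (auto simp: b_def sum_nonneg_eq_0_iff)
  have "eigenvector S (vec n x) l"
    unfolding eigenvector_def
  proof (intro conjI)
    show "vec n x \<in> carrier_vec (dim_row S)" using S by simp
    show "vec n x \<noteq> 0\<^sub>v (dim_row S)"
    proof
      assume "vec n x = 0\<^sub>v (dim_row S)"
      then have "x i = 0" if "i < n" for i
        using that S by (metis carrier_matD(1) index_vec index_zero_vec(1))
      with xx show False by simp
    qed
    show "S *\<^sub>v vec n x = l \<cdot>\<^sub>v vec n x"
      unfolding vec_mat_apply[OF S(1)] using e0 by (intro eq_vecI) (auto simp: e_def)
  qed
  then have l: "l \<in> spectrum S" by (auto simp: spectrum_def eigenvalue_def)
  then show "spectrum S \<noteq> {}" by auto
  have "Min (spectrum S) \<le> l" using l card_finite_spectrum(1)[OF S(1)] by simp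
  then have "Min (spectrum S) * (\<Sum>i<n. (z i)\<^sup>2) \<le> l * (\<Sum>i<n. (z i)\<^sup>2)"
    by (intro mult_right_mono sum_nonneg) auto
  with ge show "Min (spectrum S) * (\<Sum>i<n. (z i)\<^sup>2) \<le> qform n S z" by (meson order_trans)
qed

lemma sigma_star_positive_definite:
  assumes S: "S \<in> carrier_mat n n" "transpose_mat S = S" and n: "n > 0"
    and pd: "positive_definite n S"
  shows "sigma_star S > 0" and "(sigma_star S)\<^sup>2 * (\<Sum>i<n. (z i)\<^sup>2) \<le> qform n S z"
proof -
  have "Min (spectrum S) \<in> spectrum S"
    using Min_spectrum_le_qform(1)[OF S n] card_finite_spectrum(1)[OF S(1)] by (rule Min_in[rotated])
  then obtain x where x: "x \<in> carrier_vec n" "x \<noteq> 0\<^sub>v n" "S *\<^sub>v x = Min (spectrum S) \<cdot>\<^sub>v x"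
    using S by (auto simp: spectrum_def eigenvalue_def eigenvector_def)
  have "0 < scalar_prod x (S *\<^sub>v x)" using pd x by (auto simp: positive_definite_def)
  also have "\<dots> = Min (spectrum S) * scalar_prod x x" using x by simp
  finally have "Min (spectrum S) > 0"
    using sum_nonneg[of "{0..<dim_vec x}" "\<lambda>i. vec_index x i * vec_index x i"]
    by (simp add: scalar_prod_def zero_less_mult_iff)
  then show "sigma_star S > 0" and "(sigma_star S)\<^sup>2 * (\<Sum>i<n. (z i)\<^sup>2) \<le> qform n S z"
    using Min_spectrum_le_qform(2)[OF S n] by (auto simp: sigma_star_def)
qed


section \<open>Splitting an isotropic part off a Gaussian law\<close>

lemma positive_definite_inverse:
  assumes A: "A \<in> carrier_mat n n" "transpose_mat A = A" and pd: "positive_definite n A"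
  obtains B where "B \<in> carrier_mat n n" "A * B = 1\<^sub>m n" "B * A = 1\<^sub>m n" "transpose_mat B = B"
    "positive_definite n B" "mat_inverse A = Some B" "Determinant.det B = 1 / Determinant.det A"
proof -
  have d: "Determinant.det A > 0" by (rule gaussian_mass[OF A pd])
  then have "A \<in> Units (ring_mat TYPE(real) n ())"
    by (intro det_non_zero_imp_unit[OF A(1)]) auto
  with mat_inverse(1)[OF A(1), where b = "()"] obtain B where inv: "mat_inverse A = Some B" by (cases "mat_inverse A") auto
  note B = mat_inverse(2)[OF A(1) inv]
  have Bc: "B \<in> carrier_mat n n" using B by simp
  have "transpose_mat (A * B) = transpose_mat B * A"
    using transpose_mult[OF A(1) Bc] A(2) by simp
  then have BtA: "transpose_mat B * A = 1\<^sub>m n" using B by simp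
  have Bt: "transpose_mat B \<in> carrier_mat n n" using Bc by simp
  have "transpose_mat B = transpose_mat B * (A * B)" using B right_mult_one_mat[OF Bt] by simp
  also have "\<dots> = (transpose_mat B * A) * B"
    by (rule assoc_mult_mat[symmetric]) (use A Bc in auto)
  also have "\<dots> = B" using BtA Bc by simp
  finally have sym: "transpose_mat B = B" .
  have "positive_definite n B"
    unfolding positive_definite_def
  proof (intro ballI impI)
    fix x :: "real vec" assume x: "x \<in> carrier_vec n" "x \<noteq> 0\<^sub>v n"
    define y where "y = B *\<^sub>v x"
    have y: "y \<in> carrier_vec n" using Bc x by (simp add: y_def)
    have "A *\<^sub>v y = (A * B) *\<^sub>v x"
      unfolding y_def by (rule assoc_mult_mat_vec[symmetric, OF A(1) Bc x(1)])
    then have Ay: "A *\<^sub>v y = x" using B x by simp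
    then have "y \<noteq> 0\<^sub>v n" using x A by auto
    then have "0 < scalar_prod y (A *\<^sub>v y)" using pd y by (auto simp: positive_definite_def)
    also have "\<dots> = scalar_prod x (B *\<^sub>v x)"
      unfolding Ay by (simp add: y_def comm_scalar_prod[OF y[unfolded y_def] x(1)])
    finally show "scalar_prod x (B *\<^sub>v x) > 0" .
  qed
  moreover have "Determinant.det A * Determinant.det B = 1"
    using det_mult[OF A(1) Bc] B by simp
  then have "Determinant.det B = 1 / Determinant.det A" using d by (simp add: field_simps)
  ultimately show ?thesis using that B sym inv Bc by blast
qed

text \<open>
  Let \<open>X\<close> and \<open>Y\<close> be independent with laws \<open>N(0, T)\<close> and \<open>N(0, s\<^sup>2 I)\<close>, and let \<open>Z = X + Y\<close>,
  which has covariance \<open>S\<close>.  The left-hand side is the exponent of the joint density of \<open>X\<close> and \<open>Z\<close>; on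
  the right it is split into those of the conditional law of \<open>X\<close> given \<open>Z = z\<close>, whose mean is
  \<open>c\<close>, and of the law of \<open>Z\<close>.
\<close>

lemma gaussian_complete_square:
  fixes x z :: "nat \<Rightarrow> real"
  assumes S: "S \<in> carrier_mat n n" and B: "B \<in> carrier_mat n n" "transpose_mat B = B"
    and P: "P \<in> carrier_mat n n" "S * P = 1\<^sub>m n"
    and T: "T \<in> carrier_mat n n" "B * T = 1\<^sub>m n" "S = T + s\<^sup>2 \<cdot>\<^sub>m 1\<^sub>m n" and s: "s > 0"
  defines "c \<equiv> mat_apply n T (mat_apply n P z)"
  shows "qform n B x + (\<Sum>i<n. (z i - x i)\<^sup>2) / s\<^sup>2
    = qform n B (\<lambda>i. x i - c i) + (\<Sum>i<n. (x i - c i)\<^sup>2) / s\<^sup>2 + qform n P z"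
proof -
  define p where "p = mat_apply n P z"
  have "vec n (mat_apply n B c) = B *\<^sub>v (T *\<^sub>v vec n p)"
    using T B by (simp add: vec_mat_apply c_def p_def)
  also have "\<dots> = (B * T) *\<^sub>v vec n p"
    by (rule assoc_mult_mat_vec[symmetric]) (use T B in auto)
  finally have "vec n (mat_apply n B c) = vec n p" using T by simp
  \<comment> \<open>with \<open>p = P z\<close>, every term is a combination of \<open>x\<close>, \<open>c\<close> and \<open>p\<close>, because \<open>B c = p\<close> and \<open>z = c + s\<^sup>2 p\<close>\<close>
  then have Bc: "mat_apply n B c i = p i" if "i < n" for i
    using that by (metis index_vec)
  have "vec n z = (S * P) *\<^sub>v vec n z" using P by simp
  also have "\<dots> = S *\<^sub>v (P *\<^sub>v vec n z)"
    by (rule assoc_mult_mat_vec) (use P S in auto)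
  also have "\<dots> = vec n (mat_apply n S p)"
    using P S by (simp add: vec_mat_apply p_def)
  finally have zz: "z i = mat_apply n S p i" if "i < n" for i
    using that by (metis index_vec)
  have z: "z i = c i + s\<^sup>2 * p i" if "i < n" for i
  proof -
    have "mat_apply n S p i = (\<Sum>j<n. T $$ (i, j) * p j + (if j = i then s\<^sup>2 * p j else 0))"
      unfolding mat_apply_def T(3) using that T(1) by (intro sum.cong refl) (auto simp: algebra_simps)
    also have "\<dots> = c i + s\<^sup>2 * p i"
      using that by (simp add: sum.distrib c_def p_def mat_apply_def)
    finally show ?thesis using zz that by simp
  qed
  have "qform n B (\<lambda>i. x i + (-1) * c i)
      = qform n B x - 2 * (\<Sum>i<n. x i * mat_apply n B c i) + (\<Sum>i<n. c i * mat_apply n B c i)"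
    unfolding qform_add_scaled[OF B] sum_mat_apply_symmetric[OF B, of c x]
    by (simp add: qform_eq_sum_mat_apply)
  also have "\<dots> = qform n B x - 2 * (\<Sum>i<n. x i * p i) + (\<Sum>i<n. c i * p i)"
    using Bc by simp
  finally have q: "qform n B (\<lambda>i. x i - c i) = qform n B x - 2 * (\<Sum>i<n. x i * p i) + (\<Sum>i<n. c i * p i)"
    by simp
  have "(\<Sum>i<n. (z i - x i)\<^sup>2 / s\<^sup>2)
      = (\<Sum>i<n. - 2 * (x i * p i) + c i * p i + (x i - c i)\<^sup>2 / s\<^sup>2 + z i * p i)"
  proof (intro sum.cong refl)
    fix i assume "i \<in> {..<n}"
    then have "z i = c i + s\<^sup>2 * p i" using z by simp
    then show "(z i - x i)\<^sup>2 / s\<^sup>2 = - 2 * (x i * p i) + c i * p i + (x i - c i)\<^sup>2 / s\<^sup>2 + z i * p i"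
      using s by (simp add: power2_eq_square field_simps)
  qed
  then show ?thesis
    unfolding q sum_divide_distrib
    by (simp add: sum.distrib sum_distrib_left sum_subtractf sum_negf qform_eq_sum_mat_apply p_def)
qed

lemma ennreal_prod_normal_density:
  "(\<Prod>j<n. ennreal (normal_density (x j) s (z j)))
    = ennreal ((1 / sqrt (2 * pi * s\<^sup>2)) ^ n * exp (- (\<Sum>j<n. (z j - x j)\<^sup>2) / s\<^sup>2 / 2))"
proof -
  have "(\<Prod>j<n. normal_density (x j) s (z j))
      = (\<Prod>j<n. 1 / sqrt (2 * pi * s\<^sup>2)) * exp (\<Sum>j<n. - (z j - x j)\<^sup>2 / (2 * s\<^sup>2))"
    unfolding normal_density_def prod.distrib exp_sum[OF finite_lessThan] by simp
  also have "(\<Sum>j<n. - (z j - x j)\<^sup>2 / (2 * s\<^sup>2)) = - (\<Sum>j<n. (z j - x j)\<^sup>2) / s\<^sup>2 / 2"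
    by (simp add: sum_negf sum_divide_distrib mult.commute)
  finally show ?thesis
    by (simp add: prod_ennreal normal_density_nonneg)
qed

text \<open>
  A Gaussian vector with covariance \<open>S\<close> is the sum of an independent pair with covariances
  \<open>S - s\<^sup>2 I\<close> and \<open>s\<^sup>2 I\<close>, and \<open>b\<close> is the density of the first of them.  After completing the
  square and translating by the conditional mean, the integral over \<open>x\<close> is a constant multiple of
  \<open>exp (- qform n P z / 2)\<close>.  The constant comes from integrating over \<open>z\<close> as well and exchanging
  the order of integration.
\<close>

lemma gaussian_density_mixture:
  assumes S: "S \<in> carrier_mat n n" "transpose_mat S = S" and pdS: "positive_definite n S"
    and s: "s > 0" and gt: "\<And>z. \<exists>i<n. z i \<noteq> 0 \<Longrightarrow> s\<^sup>2 * (\<Sum>i<n. (z i)\<^sup>2) < qform n S z"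
  obtains b :: "(nat \<Rightarrow> real) \<Rightarrow> ennreal"
  where "b \<in> borel_measurable (Pi\<^sub>M {..<n} (\<lambda>_. lborel))"
    and "(\<integral>\<^sup>+x. b x \<partial>Pi\<^sub>M {..<n} (\<lambda>_. lborel)) = 1"
    and "\<And>z. ennreal (exp (- scalar_prod (vec n z) (the (mat_inverse S) *\<^sub>v vec n z) / 2)
                / sqrt ((2 * pi) ^ n * Determinant.det S))
             = (\<integral>\<^sup>+x. b x * (\<Prod>j<n. ennreal (normal_density (x j) s (z j))) \<partial>Pi\<^sub>M {..<n} (\<lambda>_. lborel))"
proof -
  let ?M = "Pi\<^sub>M {..<n} (\<lambda>_. lborel :: real measure)"
  interpret product_sigma_finite "\<lambda>_::nat. lborel :: real measure"
    by standard
  interpret M: finite_product_sigma_finite "\<lambda>_::nat. lborel :: real measure" "{..<n}"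
    by standard auto
  interpret MM: pair_sigma_finite ?M ?M
    by standard
  define T where "T = mat n n (\<lambda>(i, j). S $$ (i, j) - (if i = j then s\<^sup>2 else 0))"
  have Tc: "T \<in> carrier_mat n n" by (simp add: T_def)
  have Tt: "transpose_mat T = T"
    using symmetric_mat_entries[OF S] by (intro eq_matI) (auto simp: T_def)
  have ST: "S = T + s\<^sup>2 \<cdot>\<^sub>m 1\<^sub>m n"
    using S by (intro eq_matI) (auto simp: T_def)
  have qT: "qform n T z = qform n S z - s\<^sup>2 * (\<Sum>i<n. (z i)\<^sup>2)" for z
  proof -
    have "qform n T z = (\<Sum>i<n. \<Sum>j<n. S $$ (i, j) * z i * z j - (if j = i then s\<^sup>2 * (z i)\<^sup>2 else 0))"
      unfolding qform_def by (intro sum.cong refl) (auto simp: T_def algebra_simps power2_eq_square)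
    then show ?thesis
      by (simp add: sum_subtractf qform_def sum_distrib_left)
  qed
  have pdT: "positive_definite n T"
    unfolding positive_definite_iff_qform[OF Tc] qT using gt by auto
  obtain P where P: "P \<in> carrier_mat n n" "S * P = 1\<^sub>m n" "transpose_mat P = P" "positive_definite n P"
    "mat_inverse S = Some P" "Determinant.det P = 1 / Determinant.det S"
    using positive_definite_inverse[OF S pdS] by metis
  obtain B where B: "B \<in> carrier_mat n n" "B * T = 1\<^sub>m n" "transpose_mat B = B" "positive_definite n B"
    using positive_definite_inverse[OF Tc Tt pdT] by metis
  define \<gamma> where "\<gamma> = sqrt ((2 * pi) ^ n / Determinant.det P)"
  define \<beta> where "\<beta> = sqrt ((2 * pi) ^ n / Determinant.det B)"
  have \<gamma>: "\<gamma> > 0" "(\<integral>\<^sup>+z. ennreal (exp (- qform n P z / 2)) \<partial>?M) = ennreal \<gamma>"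
    using gaussian_mass[OF P(1,3,4)] by (auto simp: \<gamma>_def)
  have \<beta>: "\<beta> > 0" "(\<integral>\<^sup>+z. ennreal (exp (- qform n B z / 2)) \<partial>?M) = ennreal \<beta>"
    using gaussian_mass[OF B(1,3,4)] by (auto simp: \<beta>_def)
  define k where "k = (\<lambda>z x. \<Prod>j<n. ennreal (normal_density (x j) s (z j)))"
  define \<nu> where "\<nu> = (1 / sqrt (2 * pi * s\<^sup>2)) ^ n"
  have \<nu>: "\<nu> \<ge> 0" by (simp add: \<nu>_def)
  define h where "h = (\<lambda>x. ennreal (\<nu> * exp (- (qform n B x + (\<Sum>i<n. (x i)\<^sup>2) / s\<^sup>2) / 2)))"
  have h_cong: "h x = h y" if "\<And>i. i < n \<Longrightarrow> x i = y i" for x y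
    using that qform_cong[of n x y B] by (simp add: h_def)
  have [measurable]: "h \<in> borel_measurable ?M" unfolding h_def by measurable
  have k_meas [measurable]: "(\<lambda>(x, z). k z x) \<in> borel_measurable (?M \<Otimes>\<^sub>M ?M)"
    unfolding k_def normal_density_def by measurable
  have [measurable]: "(\<lambda>x. k z x) \<in> borel_measurable ?M" "(\<lambda>z. k z x) \<in> borel_measurable ?M" for x z
    unfolding k_def normal_density_def by measurable
  define c0 where "c0 = (\<integral>\<^sup>+x. h x \<partial>?M)"
  have exp_half: "exp (- (u + v) / 2) = exp (- u / 2) * exp (- v / 2)" for u v :: real
    by (simp add: exp_add[symmetric] add_divide_distrib[symmetric])
  have conv: "(\<integral>\<^sup>+x. ennreal (exp (- qform n B x / 2)) * k z x \<partial>?M) = ennreal (exp (- qform n P z / 2)) * c0" for z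
  proof -
    define c where "c = mat_apply n T (mat_apply n P z)"
    have "ennreal (exp (- qform n B x / 2)) * k z x
        = ennreal (exp (- qform n P z / 2)) * h (\<lambda>i\<in>{..<n}. x i - c i)" for x
    proof -
      have "ennreal (exp (- qform n B x / 2)) * k z x
          = ennreal (\<nu> * exp (- (qform n B x + (\<Sum>i<n. (z i - x i)\<^sup>2) / s\<^sup>2) / 2))"
        unfolding k_def ennreal_prod_normal_density \<nu>_def[symmetric] using \<nu>
        by (simp add: ennreal_mult'[symmetric] exp_add[symmetric] add_divide_distrib[symmetric]
            mult.left_commute del: ennreal_mult'')
      also have "\<dots> = ennreal (\<nu> * exp (- (qform n B (\<lambda>i. x i - c i) + (\<Sum>i<n. (x i - c i)\<^sup>2) / s\<^sup>2) / 2)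
            * exp (- qform n P z / 2))"
        unfolding gaussian_complete_square[OF S(1) B(1,3) P(1,2) Tc B(2) ST s, of x z] c_def
        by (simp only: exp_half mult.assoc)
      also have "\<dots> = ennreal (exp (- qform n P z / 2)) * h (\<lambda>i. x i - c i)"
        using \<nu> by (simp add: h_def ennreal_mult' mult.commute)
      also have "h (\<lambda>i. x i - c i) = h (\<lambda>i\<in>{..<n}. x i - c i)"
        by (rule h_cong) auto
      finally show ?thesis .
    qed
    then have "(\<integral>\<^sup>+x. ennreal (exp (- qform n B x / 2)) * k z x \<partial>?M)
        = (\<integral>\<^sup>+x. ennreal (exp (- qform n P z / 2)) * h (\<lambda>i\<in>{..<n}. x i - c i) \<partial>?M)"
      by simp
    also have "\<dots> = ennreal (exp (- qform n P z / 2)) * (\<integral>\<^sup>+x. h (\<lambda>i\<in>{..<n}. x i - c i) \<partial>?M)"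
      by (rule nn_integral_cmult) measurable
    also have "(\<integral>\<^sup>+x. h (\<lambda>i\<in>{..<n}. x i - c i) \<partial>?M) = c0"
      unfolding c0_def by (rule nn_integral_PiM_translate) measurable
    finally show ?thesis .
  qed
  have one: "(\<integral>\<^sup>+z. k z x \<partial>?M) = 1" for x
    unfolding k_def using s
    by (subst product_nn_integral_prod) (auto simp: nn_integral_normal_density)
  have "ennreal \<gamma> * c0 = (\<integral>\<^sup>+z. (\<integral>\<^sup>+x. ennreal (exp (- qform n B x / 2)) * k z x \<partial>?M) \<partial>?M)"
    unfolding conv \<gamma>(2)[symmetric] by (rule nn_integral_multc[symmetric]) measurable
  also have "\<dots> = (\<integral>\<^sup>+x. (\<integral>\<^sup>+z. ennreal (exp (- qform n B x / 2)) * k z x \<partial>?M) \<partial>?M)"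
    by (rule MM.Fubini') measurable
  also have "\<dots> = ennreal \<beta>"
    unfolding \<beta>(2)[symmetric] by (intro nn_integral_cong) (simp add: nn_integral_cmult one)
  finally have gc: "ennreal \<gamma> * c0 = ennreal \<beta>" .
  have c0: "c0 = ennreal (\<beta> / \<gamma>)"
  proof -
    have "c0 = ennreal (1 / \<gamma>) * (ennreal \<gamma> * c0)"
      using \<gamma>(1) by (simp add: mult.assoc[symmetric] ennreal_mult'[symmetric] del: ennreal_mult'')
    then show ?thesis
      unfolding gc using \<gamma>(1) \<beta>(1) by (simp add: ennreal_mult'[symmetric] del: ennreal_mult'')
  qed
  define b where "b = (\<lambda>x. ennreal (1 / \<beta>) * ennreal (exp (- qform n B x / 2)))"
  show ?thesis
  proof (rule that[of b])
    show "b \<in> borel_measurable ?M" unfolding b_def by measurable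
    show "(\<integral>\<^sup>+x. b x \<partial>?M) = 1"
      unfolding b_def using \<beta>(1)
      by (subst nn_integral_cmult) (auto simp only: \<beta>(2), auto simp: ennreal_mult'[symmetric])
    fix z :: "nat \<Rightarrow> real"
    have "(\<integral>\<^sup>+x. b x * (\<Prod>j<n. ennreal (normal_density (x j) s (z j))) \<partial>?M)
        = (\<integral>\<^sup>+x. ennreal (1 / \<beta>) * (ennreal (exp (- qform n B x / 2)) * k z x) \<partial>?M)"
      by (simp add: b_def k_def mult.assoc)
    also have "\<dots> = ennreal (1 / \<beta>) * (ennreal (exp (- qform n P z / 2)) * c0)"
      unfolding conv[symmetric] by (rule nn_integral_cmult) measurable
    also have "\<dots> = ennreal (exp (- qform n P z / 2) / \<gamma>)"
      unfolding c0 using \<beta>(1) \<gamma>(1) by (simp add: ennreal_mult'[symmetric] del: ennreal_mult'')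
    also have "\<gamma> = sqrt ((2 * pi) ^ n * Determinant.det S)"
      by (simp add: \<gamma>_def P)
    finally show "ennreal (exp (- scalar_prod (vec n z) (the (mat_inverse S) *\<^sub>v vec n z) / 2)
                / sqrt ((2 * pi) ^ n * Determinant.det S))
             = (\<integral>\<^sup>+x. b x * (\<Prod>j<n. ennreal (normal_density (x j) s (z j))) \<partial>?M)"
      using scalar_prod_mult_mat_vec_eq_qform[OF P(1)] by (simp add: P)
  qed
qed

section \<open>Derivatives and tails of the normal distribution function\<close>

definition normal_cdf :: "real \<Rightarrow> real" where
  "normal_cdf x = measure (density lborel (\<lambda>x. ennreal (std_normal_density x))) {..x}"

interpretation std_normal: prob_space "density lborel (\<lambda>x. ennreal (std_normal_density x))"
  by (rule prob_space_normal_density) simp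

interpretation std_normal: real_distribution "density lborel (\<lambda>x. ennreal (std_normal_density x))"
  by standard auto

lemma normal_cdf_bounds: "0 \<le> normal_cdf x" "normal_cdf x \<le> 1"
  by (auto simp: normal_cdf_def)

lemma normal_cdf_eq_cdf: "normal_cdf = cdf (density lborel (\<lambda>x. ennreal (std_normal_density x)))"
  by (simp add: fun_eq_iff cdf_def normal_cdf_def)

lemma normal_cdf_mono: "x \<le> y \<Longrightarrow> normal_cdf x \<le> normal_cdf y"
  unfolding normal_cdf_eq_cdf by (rule std_normal.cdf_nondecreasing)

lemma normal_cdf_diff_eq_integral:
  assumes "x \<le> y"
  shows "normal_cdf y - normal_cdf x = integral {x..y} std_normal_density"
proof (cases "x < y")
  case True
  let ?M = "density lborel (\<lambda>x. ennreal (std_normal_density x))"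
  have int: "set_integrable lborel {x..y} std_normal_density"
    by (rule borel_integrable_atLeastAtMost') (auto simp: normal_density_def intro!: continuous_intros)
  have "ennreal (normal_cdf y - normal_cdf x) = emeasure ?M {x<..y}"
    using True by (simp add: normal_cdf_eq_cdf std_normal.cdf_diff_eq std_normal.emeasure_eq_measure)
  also have "\<dots> = (\<integral>\<^sup>+t. ennreal (std_normal_density t) * indicator {x<..y} t \<partial>lborel)"
    by (subst emeasure_density) auto
  also have "\<dots> = (\<integral>\<^sup>+t. ennreal (indicator {x..y} t *\<^sub>R std_normal_density t) \<partial>lborel)"
    using AE_lborel_singleton[of x]
    by (intro nn_integral_cong_AE) (auto elim!: eventually_mono simp: indicator_def normal_density_nonneg)
  also have "\<dots> = ennreal (\<integral>t. indicator {x..y} t *\<^sub>R std_normal_density t \<partial>lborel)"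
    using int unfolding set_integrable_def
    by (intro nn_integral_eq_integral) (auto simp: normal_density_nonneg)
  also have "(\<integral>t. indicator {x..y} t *\<^sub>R std_normal_density t \<partial>lborel) = integral {x..y} std_normal_density"
    using set_borel_integral_eq_integral(2)[OF int] by (simp add: set_lebesgue_integral_def)
  finally show ?thesis
    using normal_cdf_mono[OF assms] integral_nonneg[OF set_borel_integral_eq_integral(1)[OF int]]
    by (subst (asm) ennreal_inj) (auto simp: normal_density_nonneg)
next
  case False
  with assms show ?thesis by simp
qed

lemma DERIV_normal_cdf: "(normal_cdf has_real_derivative std_normal_density x) (at x)"
proof -
  have "((\<lambda>u. integral {x - 1..u} std_normal_density) has_real_derivative std_normal_density x) (at x within {x - 1..x + 1})"
    by (rule integral_has_real_derivative) (auto simp: normal_density_def intro!: continuous_intros)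
  then have "((\<lambda>u. integral {x - 1..u} std_normal_density) has_real_derivative std_normal_density x) (at x)"
    by (subst (asm) at_within_interior) auto
  then have D: "((\<lambda>u. normal_cdf (x - 1) + integral {x - 1..u} std_normal_density) has_real_derivative std_normal_density x) (at x)"
    by (auto intro!: derivative_eq_intros)
  have "eventually (\<lambda>u. u > x - 1) (nhds x)"
    using eventually_nhds_in_open[of "{x - 1<..}" x] by simp
  then have ev: "eventually (\<lambda>u. normal_cdf (x - 1) + integral {x - 1..u} std_normal_density = normal_cdf u) (nhds x)"
  proof (rule eventually_mono)
    fix u assume "u > x - 1"
    then show "normal_cdf (x - 1) + integral {x - 1..u} std_normal_density = normal_cdf u"
      using normal_cdf_diff_eq_integral[of "x - 1" u] by simp
  qed
  show ?thesis
    using D unfolding DERIV_cong_ev[OF refl ev refl] .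
qed

text \<open>
  The sum \<open>normal_cdf x + normal_cdf (- x)\<close> has derivative 0 and tends to 1.
\<close>

lemma normal_cdf_minus: "normal_cdf (- x) = 1 - normal_cdf x"
proof -
  let ?f = "\<lambda>x. normal_cdf x + normal_cdf (- x)"
  have "(?f has_real_derivative 0) (at x)" for x
  proof -
    have "((\<lambda>x. normal_cdf (- x)) has_real_derivative std_normal_density (- x) * - 1) (at x)"
      by (rule DERIV_chain2[OF DERIV_normal_cdf]) (auto intro!: derivative_eq_intros)
    moreover have "std_normal_density (- x) = std_normal_density x"
      by (simp add: normal_density_def)
    ultimately show ?thesis
      using DERIV_add[OF DERIV_normal_cdf[of x]] by fastforce
  qed
  then have const: "?f y = ?f x" for y
    by (metis DERIV_isconst_all)
  have "(normal_cdf \<longlongrightarrow> 1) at_top"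
    unfolding normal_cdf_eq_cdf by (rule std_normal.cdf_lim_at_top_prob)
  moreover have "((\<lambda>x. normal_cdf (- x)) \<longlongrightarrow> 0) at_top"
    unfolding normal_cdf_eq_cdf
    by (rule filterlim_compose[OF std_normal.cdf_lim_at_bot filterlim_uminus_at_bot_at_top])
  ultimately have "(?f \<longlongrightarrow> 1 + 0) at_top" by (rule tendsto_add)
  moreover have "(?f \<longlongrightarrow> ?f x) at_top"
    using const by (intro tendsto_eventually always_eventually) auto
  ultimately have "?f x = 1 + 0"
    by (intro tendsto_unique[OF trivial_limit_at_top_linorder]) 
  then show ?thesis by simp
qed

text \<open>
  Up to the sign \<open>(- 1) ^ r\<close> these are the probabilists' Hermite polynomials: \<open>hermite r\<close> times
  the standard normal density is the \<open>r\<close>-th derivative of that density.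
\<close>

primrec hermite :: "nat \<Rightarrow> real poly" where
  "hermite 0 = 1"
| "hermite (Suc r) = pderiv (hermite r) - [:0, 1:] * hermite r"

fun normal_deriv :: "nat \<Rightarrow> real \<Rightarrow> real" where
  "normal_deriv 0 x = normal_cdf x"
| "normal_deriv (Suc r) x = poly (hermite r) x * std_normal_density x"

lemma DERIV_std_normal_density:
  "(std_normal_density has_real_derivative - x * std_normal_density x) (at x)"
  unfolding normal_density_def by (auto intro!: derivative_eq_intros simp: field_simps)

lemma DERIV_normal_deriv: "(normal_deriv r has_real_derivative normal_deriv (Suc r) x) (at x)"
proof (cases r)
  case 0
  have "normal_deriv 0 = normal_cdf" by (auto simp: fun_eq_iff)
  then show ?thesis using 0 DERIV_normal_cdf by simp
next
  case (Suc q)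
  have eq: "normal_deriv (Suc q) = (\<lambda>x. poly (hermite q) x * std_normal_density x)"
    by (simp add: fun_eq_iff)
  have "((\<lambda>x. poly (hermite q) x * std_normal_density x) has_real_derivative
      poly (pderiv (hermite q)) x * std_normal_density x + (- x * std_normal_density x) * poly (hermite q) x) (at x)"
    by (rule DERIV_mult[OF poly_DERIV DERIV_std_normal_density])
  then show ?thesis
    unfolding Suc eq by (simp add: algebra_simps)
qed

lemma degree_hermite: "degree (hermite r) \<le> r"
proof (induction r)
  case (Suc r)
  have "degree (pderiv (hermite r)) \<le> Suc r"
    using degree_pderiv_le[of "hermite r"] Suc by linarith
  moreover have "degree ([:0, 1:] * hermite r) \<le> Suc r"
    using degree_mult_le[of "[:0, 1:]" "hermite r"] Suc by simp
  ultimately show ?case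
    by (simp only: hermite.simps) (rule degree_diff_le)
qed simp

lemma abs_poly_le:
  fixes p :: "real poly"
  assumes "degree p \<le> n"
  shows "\<bar>poly p x\<bar> \<le> (\<Sum>i\<le>degree p. \<bar>coeff p i\<bar>) * (1 + \<bar>x\<bar>) ^ n"
proof -
  have "\<bar>poly p x\<bar> \<le> (\<Sum>i\<le>degree p. \<bar>coeff p i * x ^ i\<bar>)"
    unfolding poly_altdef by (rule sum_abs)
  also have "\<dots> \<le> (\<Sum>i\<le>degree p. \<bar>coeff p i\<bar> * (1 + \<bar>x\<bar>) ^ n)"
  proof (rule sum_mono)
    fix i assume "i \<in> {..degree p}"
    then have i: "i \<le> n" using assms by simp
    have "\<bar>x\<bar> ^ i \<le> (1 + \<bar>x\<bar>) ^ i" by (rule power_mono) auto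
    also have "\<dots> \<le> (1 + \<bar>x\<bar>) ^ n" using i by (rule power_increasing) auto
    finally show "\<bar>coeff p i * x ^ i\<bar> \<le> \<bar>coeff p i\<bar> * (1 + \<bar>x\<bar>) ^ n"
      by (simp add: abs_mult power_abs mult_left_mono)
  qed
  finally show ?thesis by (simp add: sum_distrib_right)
qed

lemma normal_deriv_Suc_le:
  obtains c where "c \<ge> 0" "\<And>x. \<bar>normal_deriv (Suc r) x\<bar> \<le> c * ((1 + \<bar>x\<bar>) ^ r * std_normal_density x)"
proof
  let ?c = "\<Sum>i\<le>degree (hermite r). \<bar>coeff (hermite r) i\<bar>"
  show "?c \<ge> 0" by (simp add: sum_nonneg)
  fix x
  show "\<bar>normal_deriv (Suc r) x\<bar> \<le> ?c * ((1 + \<bar>x\<bar>) ^ r * std_normal_density x)"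
    using abs_poly_le[OF degree_hermite, of r x]
    by (simp add: abs_mult normal_density_nonneg mult.assoc[symmetric] mult_right_mono)
qed

lemma power_div_fact_le_exp:
  fixes x :: real
  assumes "x \<ge> 0"
  shows "x ^ n / fact n \<le> exp x"
proof -
  have "(\<Sum>k\<in>{n}. x ^ k /\<^sub>R fact k) \<le> (\<Sum>k. x ^ k /\<^sub>R fact k)"
    using assms by (intro sum_le_suminf summable_exp_generic) auto
  then show ?thesis by (simp add: exp_def divide_inverse mult.commute)
qed

text \<open>
  The polynomial factor is absorbed by one half of the Gaussian exponent.
\<close>

lemma power_mult_std_normal_density_le:
  assumes "t \<ge> 0"
  shows "(1 + t) ^ r * std_normal_density t \<le> fact r * exp 2 * exp (- t\<^sup>2 / 4)"
proof -
  have "(1 + t) ^ r / fact r \<le> exp (1 + t)"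
    using assms by (intro power_div_fact_le_exp) auto
  then have 1: "(1 + t) ^ r \<le> fact r * exp (1 + t)" by (simp add: field_simps)
  have "1 / sqrt (2 * pi) \<le> 1"
  proof -
    have "1 \<le> sqrt (2 * pi)" using pi_gt3 by (intro real_le_rsqrt) auto
    then show ?thesis by (simp add: divide_le_eq)
  qed
  then have 2: "std_normal_density t \<le> exp (- t\<^sup>2 / 2)"
    using mult_right_mono[of "1 / sqrt (2 * pi)" 1 "exp (- t\<^sup>2 / 2)"] by (simp add: normal_density_def)
  have "(1 + t) ^ r * std_normal_density t \<le> (fact r * exp (1 + t)) * exp (- t\<^sup>2 / 2)"
    using 1 2 assms by (intro mult_mono) (auto simp: normal_density_nonneg)
  also have "\<dots> = fact r * exp (1 + t - t\<^sup>2 / 4) * exp (- t\<^sup>2 / 4)"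
    by (simp add: mult.assoc exp_add[symmetric])
  also have "exp (1 + t - t\<^sup>2 / 4) \<le> exp 2"
  proof -
    have "0 \<le> (t / 2 - 1)\<^sup>2" by simp
    then have "1 + t - t\<^sup>2 / 4 \<le> 2" by (simp add: power2_eq_square algebra_simps)
    then show ?thesis by simp
  qed
  finally show ?thesis by (simp add: mult_right_mono)
qed

text \<open>
  A lower bound of Mills type.  On the interval of length \<open>1 / (1 + z)\<close> to the right of \<open>z\<close>
  the density falls by a factor of at most \<open>exp (3 / 2)\<close>, so already this interval carries enough mass.
\<close>

lemma normal_tail_lower_bound:
  assumes z: "z \<ge> 0"
  shows "std_normal_density z \<le> exp (3 / 2) * (1 + z) * (1 - normal_cdf z)"
proof -
  define d where "d = 1 / (1 + z)"
  have d: "d > 0" "d \<le> 1" "z * d \<le> 1" using z by (auto simp: d_def field_simps)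
  obtain y where y: "z < y" "y < z + d" "normal_cdf (z + d) - normal_cdf z = (z + d - z) * std_normal_density y"
    using MVT2[of z "z + d" normal_cdf std_normal_density] DERIV_normal_cdf d by auto
  have "y\<^sup>2 \<le> (z + d)\<^sup>2" using y z by (intro power_mono) auto
  also have "\<dots> \<le> z\<^sup>2 + 3"
  proof -
    have "d\<^sup>2 \<le> 1" using d by (simp add: power_le_one)
    then show ?thesis using d by (simp add: power2_eq_square algebra_simps)
  qed
  finally have "exp (- z\<^sup>2 / 2) \<le> exp (3 / 2 + - y\<^sup>2 / 2)" by simp
  then have "std_normal_density z \<le> exp (3 / 2) * std_normal_density y"
    by (simp add: normal_density_def divide_right_mono exp_add[symmetric])
  also have "std_normal_density y = (1 + z) * (normal_cdf (z + d) - normal_cdf z)"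
    using y(3) z by (simp add: d_def)
  also have "\<dots> \<le> (1 + z) * (1 - normal_cdf z)"
    using z normal_cdf_bounds(2)[of "z + d"] by (intro mult_left_mono) auto
  finally show ?thesis by (simp add: mult.assoc)
qed

text \<open>
  The left-hand side bounds a derivative of order \<open>Suc r\<close> of the distribution function.  For
  \<open>\<bar>x\<bar> \<le> 2 * L\<close> the normal tail beyond \<open>\<bar>x\<bar> + K / L\<close> is still comparable with the
  tail beyond \<open>\<bar>x\<bar>\<close>, since the exponent changes by \<open>\<bar>x\<bar> * K / L \<le> 2 * K\<close> and by \<open>K\<^sup>2 / 2\<close> at most.
  Farther out, both the power and the density together are below a multiple of \<open>exp (- L\<^sup>2)\<close>.
\<close>

lemma power_mult_density_le_tail:
  assumes K: "K \<ge> 0"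
  obtains C where "C \<ge> 0" "\<And>L x y. L \<ge> 1 \<Longrightarrow> y \<le> \<bar>x\<bar> + K / L \<Longrightarrow>
     (1 + \<bar>x\<bar>) ^ r * std_normal_density x \<le> C * L ^ Suc r * (1 - normal_cdf y + exp (- L\<^sup>2))"
proof
  define C1 where "C1 = 3 ^ r * exp (2 * K + K\<^sup>2 / 2) * (exp (3 / 2) * (3 + K))"
  define C2 where "C2 = fact r * exp (2 :: real)"
  have C: "C1 \<ge> 0" "C2 \<ge> 0" using K by (auto simp: C1_def C2_def)
  then show "C1 + C2 \<ge> 0" by simp
  fix L x y :: real
  assume L: "L \<ge> 1" and y: "y \<le> \<bar>x\<bar> + K / L"
  define t where "t = \<bar>x\<bar>"
  define z where "z = t + K / L"
  have t: "t \<ge> 0" by (simp add: t_def)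
  have KL: "0 \<le> K / L" "K / L \<le> K" using K L by (auto simp: divide_le_eq mult_le_cancel_left1)
  have z: "z \<ge> 0" using t KL by (simp add: z_def)
  have dens: "std_normal_density x = std_normal_density t"
    by (simp add: normal_density_def t_def)
  have tail: "0 \<le> 1 - normal_cdf z" "1 - normal_cdf z \<le> 1 - normal_cdf y"
    using normal_cdf_bounds normal_cdf_mono y by (auto simp: z_def t_def)
  have Lr: "1 \<le> L ^ Suc r" using L by (rule one_le_power)
  have "(1 + t) ^ r * std_normal_density t \<le> C1 * L ^ Suc r * (1 - normal_cdf y) + C2 * L ^ Suc r * exp (- L\<^sup>2)"
  \<comment> \<open>beyond \<open>2 * L\<close> the bound \<open>exp (- t\<^sup>2 / 4)\<close> is at most \<open>exp (- L\<^sup>2)\<close>\<close>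
  proof (cases "t \<le> 2 * L")
    case True
    have "z\<^sup>2 = t\<^sup>2 + 2 * (t * (K / L)) + (K / L)\<^sup>2"
      by (simp add: z_def power2_eq_square algebra_simps)
    also have "t * (K / L) \<le> 2 * L * (K / L)" using True KL by (intro mult_right_mono)
    also have "2 * L * (K / L) = 2 * K" using L by simp
    also have "(K / L)\<^sup>2 \<le> K\<^sup>2" using KL by (intro power_mono)
    finally have "exp (- t\<^sup>2 / 2) \<le> exp (2 * K + K\<^sup>2 / 2 + - z\<^sup>2 / 2)" by simp
    then have 1: "std_normal_density t \<le> exp (2 * K + K\<^sup>2 / 2) * std_normal_density z"
      by (simp add: normal_density_def divide_right_mono exp_add[symmetric])
    have "1 + z \<le> (3 + K) * L"
    proof -
      have "1 + z \<le> 1 + 2 * L + K" using True KL by (simp add: z_def)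
      also have "\<dots> \<le> (3 + K) * L"
        using L K mult_left_mono[of 1 L K] by (simp add: distrib_right)
      finally show ?thesis .
    qed
    then have "exp (3 / 2) * (1 + z) * (1 - normal_cdf z) \<le> exp (3 / 2) * ((3 + K) * L) * (1 - normal_cdf y)"
      using tail z by (intro mult_mono mult_left_mono) auto
    with normal_tail_lower_bound[OF z]
    have 2: "std_normal_density z \<le> exp (3 / 2) * ((3 + K) * L) * (1 - normal_cdf y)" by linarith
    have 3: "(1 + t) ^ r \<le> (3 * L) ^ r" using True t L by (intro power_mono) auto
    have "std_normal_density t \<le> exp (2 * K + K\<^sup>2 / 2) * (exp (3 / 2) * ((3 + K) * L) * (1 - normal_cdf y))"
      by (rule order_trans[OF 1 mult_left_mono[OF 2]]) simp
    then have "(1 + t) ^ r * std_normal_density t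
        \<le> (3 * L) ^ r * (exp (2 * K + K\<^sup>2 / 2) * (exp (3 / 2) * ((3 + K) * L) * (1 - normal_cdf y)))"
      using 3 L by (intro mult_mono) (auto simp: normal_density_nonneg)
    also have "\<dots> = C1 * L ^ Suc r * (1 - normal_cdf y)"
      by (simp add: C1_def power_mult_distrib mult_ac)
    finally show ?thesis using C Lr by (simp add: add_increasing2)
  next
    case False
    have "(2 * L)\<^sup>2 \<le> t\<^sup>2" using False L by (intro power_mono) auto
    then have "exp (- t\<^sup>2 / 4) \<le> exp (- L\<^sup>2)" by (simp add: power2_eq_square)
    then have "C2 * exp (- t\<^sup>2 / 4) \<le> C2 * exp (- L\<^sup>2)" using C by (intro mult_left_mono)
    also have "\<dots> \<le> C2 * exp (- L\<^sup>2) * L ^ Suc r"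
      using Lr C mult_left_mono[OF Lr, of "C2 * exp (- L\<^sup>2)"] by simp
    finally have 1: "C2 * exp (- t\<^sup>2 / 4) \<le> C2 * exp (- L\<^sup>2) * L ^ Suc r" .
    have "(1 + t) ^ r * std_normal_density t \<le> C2 * exp (- t\<^sup>2 / 4)"
      unfolding C2_def by (rule power_mult_std_normal_density_le[OF t])
    also note 1
    also have "C2 * exp (- L\<^sup>2) * L ^ Suc r = C2 * L ^ Suc r * exp (- L\<^sup>2)"
      by (simp only: mult_ac)
    finally have "(1 + t) ^ r * std_normal_density t \<le> C2 * L ^ Suc r * exp (- L\<^sup>2)" .
    moreover have "0 \<le> C1 * L ^ Suc r * (1 - normal_cdf y)"
      using C Lr tail by (intro mult_nonneg_nonneg) auto
    ultimately show ?thesis by linarith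
  qed
  also have "\<dots> \<le> (C1 + C2) * L ^ Suc r * (1 - normal_cdf y + exp (- L\<^sup>2))"
  proof -
    have "0 \<le> C1 * L ^ Suc r * exp (- L\<^sup>2)" "0 \<le> C2 * L ^ Suc r * (1 - normal_cdf y)"
      using C Lr tail by (auto intro!: mult_nonneg_nonneg)
    then show ?thesis by (simp only: distrib_left distrib_right)
  qed
  finally show "(1 + \<bar>x\<bar>) ^ r * std_normal_density x \<le> (C1 + C2) * L ^ Suc r * (1 - normal_cdf y + exp (- L\<^sup>2))"
    unfolding dens t_def .
qed

section \<open>Normal probabilities of intervals\<close>

lemma normal_deriv_bounded:
  obtains c where "c \<ge> 0" "\<And>x. \<bar>normal_deriv r x\<bar> \<le> c"
proof (cases r)
  case 0
  show ?thesis
    by (rule that[of 1]) (use 0 normal_cdf_bounds in \<open>auto simp: abs_le_iff intro: order_trans[of _ 0]\<close>)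
next
  case (Suc q)
  obtain c where c: "c \<ge> 0" "\<And>x. \<bar>normal_deriv (Suc q) x\<bar> \<le> c * ((1 + \<bar>x\<bar>) ^ q * std_normal_density x)"
    using normal_deriv_Suc_le by metis
  show ?thesis
  proof (rule that[of "c * (fact q * exp 2)"])
    fix x
    have "(1 + \<bar>x\<bar>) ^ q * std_normal_density x \<le> fact q * exp 2 * exp (- \<bar>x\<bar>\<^sup>2 / 4)"
      using power_mult_std_normal_density_le[of "\<bar>x\<bar>" q] by (simp add: normal_density_def)
    also have "\<dots> \<le> fact q * exp 2 * 1"
      by (intro mult_left_mono) auto
    finally show "\<bar>normal_deriv r x\<bar> \<le> c * (fact q * exp 2)"
      using c(1) order_trans[OF c(2)[of x] mult_left_mono] unfolding Suc by simp
  qed (use c in auto)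
qed

text \<open>
  The contribution of one end \<open>e\<close> of an interval to a derivative of the probability of the
  interval.  At an infinite end the normal distribution function and its derivatives are replaced by
  their limits.
\<close>

definition end_deriv :: "nat \<Rightarrow> real \<Rightarrow> ereal \<Rightarrow> real \<Rightarrow> real" where
  "end_deriv r h e s = (case e of ereal b \<Rightarrow> normal_deriv r ((b - s) / h)
     | PInfty \<Rightarrow> (if r = 0 then 1 else 0) | MInfty \<Rightarrow> 0)"

lemma end_deriv_simps [simp]:
  "end_deriv r h (ereal b) s = normal_deriv r ((b - s) / h)"
  "end_deriv r h \<infinity> s = (if r = 0 then 1 else 0)"
  "end_deriv r h (- \<infinity>) s = 0"
  by (auto simp: end_deriv_def)

lemma end_deriv_bounded:
  obtains c where "c \<ge> 0" "\<And>h e s. \<bar>end_deriv r h e s\<bar> \<le> c"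
proof -
  obtain c where c: "c \<ge> 0" "\<And>x. \<bar>normal_deriv r x\<bar> \<le> c" using normal_deriv_bounded[of r] by blast
  show ?thesis
  proof (rule that[of "max c 1"])
    show "\<bar>end_deriv r h e s\<bar> \<le> max c 1" for h e s
      using c(2) by (cases e) (auto simp: le_max_iff_disj)
  qed auto
qed

lemma end_deriv_0_bounds: "0 \<le> end_deriv 0 h e s" "end_deriv 0 h e s \<le> 1"
  by (cases e; simp add: normal_cdf_bounds)+

lemma end_deriv_0_mono:
  assumes "h > 0" "e \<le> e'" "s' \<le> s"
  shows "end_deriv 0 h e s \<le> end_deriv 0 h e' s'"
  using assms normal_cdf_bounds
  by (cases e; cases e') (auto intro!: normal_cdf_mono divide_right_mono)

lemma DERIV_end_deriv:
  assumes h: "h > 0"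
  shows "(end_deriv r h e has_real_derivative - end_deriv (Suc r) h e s / h) (at s)"
proof (cases e)
  case (real b)
  have "((\<lambda>s. normal_deriv r ((b - s) / h)) has_real_derivative normal_deriv (Suc r) ((b - s) / h) * (- 1 / h)) (at s)"
    by (rule DERIV_chain2[OF DERIV_normal_deriv]) (use h in \<open>auto intro!: derivative_eq_intros\<close>)
  moreover have "end_deriv r h e = (\<lambda>s. normal_deriv r ((b - s) / h))"
    by (simp add: real fun_eq_iff)
  ultimately show ?thesis
    by (simp add: real)
next
  case PInf
  then have "end_deriv r h e = (\<lambda>s. if r = 0 then 1 else 0)" by (simp add: fun_eq_iff)
  then show ?thesis by (simp add: PInf)
next
  case MInf
  then have "end_deriv r h e = (\<lambda>s. 0)" by (simp add: fun_eq_iff)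
  then show ?thesis by (simp add: MInf)
qed

lemma measurable_end_deriv [measurable]:
  assumes "h > 0"
  shows "end_deriv r h e \<in> borel_measurable borel"
  using DERIV_end_deriv[OF assms] by (intro borel_measurable_continuous_onI) (metis DERIV_isCont continuous_at_imp_continuous_on)

text \<open>
  At \<open>p = q = t\<close> this is the \<open>r\<close>-th derivative, in \<open>t\<close>, of the probability that a normal
  variable with mean \<open>t\<close> and standard deviation \<open>h\<close> lies between \<open>a\<close> and \<open>b\<close>.  Separate arguments
  for the two ends are used because moving both ends outwards by \<open>k\<close> amounts to \<open>p = t - k\<close> and
  \<open>q = t + k\<close>.
\<close>

definition interval_deriv :: "nat \<Rightarrow> real \<Rightarrow> ereal \<Rightarrow> ereal \<Rightarrow> real \<Rightarrow> real \<Rightarrow> real" where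
  "interval_deriv r h a b p q = (- 1 / h) ^ r * (end_deriv r h b p - end_deriv r h a q)"

lemma interval_deriv_bounded:
  assumes "h > 0"
  obtains c where "c \<ge> 0" "\<And>a b p q. \<bar>interval_deriv r h a b p q\<bar> \<le> c"
proof -
  obtain c where c: "c \<ge> 0" "\<And>h e s. \<bar>end_deriv r h e s\<bar> \<le> c" using end_deriv_bounded[of r] by blast
  show ?thesis
  proof (rule that[of "(1 / h) ^ r * (c + c)"])
    fix a b p q
    have "\<bar>interval_deriv r h a b p q\<bar> = (1 / h) ^ r * \<bar>end_deriv r h b p - end_deriv r h a q\<bar>"
      using assms by (simp add: interval_deriv_def abs_mult power_abs)
    also have "\<dots> \<le> (1 / h) ^ r * (c + c)"
      using assms c(2)[of h b p] c(2)[of h a q] by (intro mult_left_mono) auto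
    finally show "\<bar>interval_deriv r h a b p q\<bar> \<le> (1 / h) ^ r * (c + c)" .
  qed (use assms c in auto)
qed

lemma DERIV_interval_deriv:
  assumes h: "h > 0"
  shows "((\<lambda>t. interval_deriv r h a b (p + t) (q + t)) has_real_derivative
    interval_deriv (Suc r) h a b (p + t) (q + t)) (at t)"
proof -
  have D: "((\<lambda>t. end_deriv r h e (p + t)) has_real_derivative - end_deriv (Suc r) h e (p + t) / h) (at t)" for e p
  proof -
    have "((\<lambda>t. p + t) has_real_derivative 1) (at t)"
      by (auto intro!: derivative_eq_intros)
    from DERIV_chain2[OF DERIV_end_deriv[OF h] this] show ?thesis by simp
  qed
  have "((\<lambda>t. (- 1 / h) ^ r * (end_deriv r h b (p + t) - end_deriv r h a (q + t))) has_real_derivative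
     (- 1 / h) ^ r * (- end_deriv (Suc r) h b (p + t) / h - - end_deriv (Suc r) h a (q + t) / h)) (at t)"
    by (intro DERIV_cmult DERIV_diff D)
  then show ?thesis
    unfolding interval_deriv_def by (simp add: diff_divide_distrib algebra_simps)
qed

lemma interval_deriv_0_nonneg:
  assumes "h > 0" "a \<le> b" "p \<le> q"
  shows "0 \<le> interval_deriv 0 h a b p q"
  using end_deriv_0_mono[OF assms] by (simp add: interval_deriv_def)

text \<open>
  At \<open>p = q = t\<close> this is the probability that a normal variable with mean \<open>t\<close> and standard
  deviation \<open>h\<close> lies outside the interval from \<open>a\<close> to \<open>b\<close>.  At \<open>p = t - k\<close> and \<open>q = t + k\<close> it is a lower
  bound for that probability at all means within distance \<open>k\<close> of \<open>t\<close>.  Unlike the infimum over these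
  means it is plainly measurable in its arguments.
\<close>

definition outside_mass :: "real \<Rightarrow> ereal \<Rightarrow> ereal \<Rightarrow> real \<Rightarrow> real \<Rightarrow> real" where
  "outside_mass h a b p q = (1 - end_deriv 0 h b p) + end_deriv 0 h a q"

lemma outside_mass_nonneg: "0 \<le> outside_mass h a b p q"
  using end_deriv_0_bounds by (simp add: outside_mass_def add_nonneg_nonneg)

lemma interval_deriv_0_le_outside_mass:
  assumes "h > 0" "\<bar>y\<bar> \<le> k"
  shows "interval_deriv 0 h a b (p + y) (q + y) \<le> 1 - outside_mass h a b (p - k) (q + k)"
proof -
  have "- k \<le> y" "y \<le> k" using assms(2) by auto
  then show ?thesis
    using end_deriv_0_mono[of h b b "p - k" "p + y"] end_deriv_0_mono[of h a a "q + y" "q + k"] assms(1)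
    by (simp add: interval_deriv_def outside_mass_def)
qed

text \<open>
  Each end contributes a derivative of the distribution function, which is compared with the
  normal tail beyond the same end.  The two points of comparison are at most \<open>2 * K / L\<close> apart
  after scaling: one \<open>K / L\<close> for \<open>y\<close>, and one for the shift by \<open>h * (K / L)\<close> in \<open>outside_mass\<close>.
\<close>

lemma interval_deriv_le_outside_mass:
  assumes K: "K \<ge> 0"
  obtains C where "C \<ge> 1" "\<And>L h a b p q y. L \<ge> 1 \<Longrightarrow> h > 0 \<Longrightarrow> \<bar>y\<bar> \<le> h * (K / L) \<Longrightarrow>
    \<bar>interval_deriv (Suc r) h a b (p + y) (q + y)\<bar>
      \<le> C * (L / h) ^ Suc r * (outside_mass h a b (p - h * (K / L)) (q + h * (K / L)) + exp (- L\<^sup>2))"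
proof -
  obtain c where c: "c \<ge> 0" "\<And>x. \<bar>normal_deriv (Suc r) x\<bar> \<le> c * ((1 + \<bar>x\<bar>) ^ r * std_normal_density x)"
    using normal_deriv_Suc_le by metis
  obtain C where C: "C \<ge> 0" "\<And>L x y. L \<ge> 1 \<Longrightarrow> y \<le> \<bar>x\<bar> + 2 * K / L \<Longrightarrow>
     (1 + \<bar>x\<bar>) ^ r * std_normal_density x \<le> C * L ^ Suc r * (1 - normal_cdf y + exp (- L\<^sup>2))"
    using power_mult_density_le_tail[of "2 * K" r] K by auto
  have main: "\<bar>normal_deriv (Suc r) x\<bar> \<le> c * C * L ^ Suc r * (1 - normal_cdf y + exp (- L\<^sup>2))"
    if "L \<ge> 1" "y \<le> \<bar>x\<bar> + 2 * K / L" for L x y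
    using order_trans[OF c(2) mult_left_mono[OF C(2)[OF that] c(1)]] by (simp add: mult.assoc)
  have nonneg: "0 \<le> c * C * L ^ Suc r * (u + exp (- L\<^sup>2))" if "L \<ge> 1" "u \<ge> 0" for L u :: real
    using c C that by (intro mult_nonneg_nonneg add_nonneg_nonneg) auto
  show ?thesis
  proof (rule that[of "2 * (c * C) + 1"])
    show "2 * (c * C) + 1 \<ge> 1" using c C by simp
    fix L h p q y :: real and a b :: ereal
    assume L: "L \<ge> 1" and h: "h > 0" and y: "\<bar>y\<bar> \<le> h * (K / L)"
    let ?k = "h * (K / L)"
    let ?e = "exp (- L\<^sup>2)"
    have yh: "- (K / L) \<le> y / h" "y / h \<le> K / L"
      using y h by (auto simp: field_simps abs_le_iff)
    have KL: "2 * K / L = K / L + K / L" by simp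
    have B: "\<bar>end_deriv (Suc r) h b (p + y)\<bar> \<le> c * C * L ^ Suc r * (1 - end_deriv 0 h b (p - ?k) + ?e)"
    proof (cases b)
      case (real b')
      have "(b' - (p - ?k)) / h = (b' - (p + y)) / h + y / h + K / L"
        using h by (simp add: field_simps)
      also have "\<dots> \<le> \<bar>(b' - (p + y)) / h\<bar> + 2 * K / L"
        using yh KL abs_ge_self[of "(b' - (p + y)) / h"] abs_ge_minus_self[of "(b' - (p + y)) / h"] by linarith
      finally show ?thesis
        using main[OF L] by (simp add: real del: normal_deriv.simps(2))
    qed (use nonneg[OF L, of 0] nonneg[OF L, of 1] in \<open>auto simp del: power_Suc\<close>)
    have A: "\<bar>end_deriv (Suc r) h a (q + y)\<bar> \<le> c * C * L ^ Suc r * (end_deriv 0 h a (q + ?k) + ?e)"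
    proof (cases a)
      case (real a')
      have "- ((a' - (q + ?k)) / h) = - ((a' - (q + y)) / h) + (- (y / h)) + K / L"
        using h by (simp add: field_simps)
      also have "\<dots> \<le> \<bar>(a' - (q + y)) / h\<bar> + 2 * K / L"
        using yh KL abs_ge_self[of "(a' - (q + y)) / h"] abs_ge_minus_self[of "(a' - (q + y)) / h"] by linarith
      finally have le: "- ((a' - (q + ?k)) / h) \<le> \<bar>(a' - (q + y)) / h\<bar> + 2 * K / L" .
      show ?thesis
        using main[OF L le] normal_cdf_minus[of "(a' - (q + ?k)) / h"] by (simp add: real del: normal_deriv.simps(2))
    qed (use nonneg[OF L, of 0] nonneg[OF L, of 1] in \<open>auto simp del: power_Suc\<close>)
    have "\<bar>interval_deriv (Suc r) h a b (p + y) (q + y)\<bar>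
        = (1 / h) ^ Suc r * \<bar>end_deriv (Suc r) h b (p + y) - end_deriv (Suc r) h a (q + y)\<bar>"
      using h by (simp add: interval_deriv_def abs_mult power_abs)
    also have "\<dots> \<le> (1 / h) ^ Suc r * (c * C * L ^ Suc r * (1 - end_deriv 0 h b (p - ?k) + ?e)
        + c * C * L ^ Suc r * (end_deriv 0 h a (q + ?k) + ?e))"
      using A B h by (intro mult_left_mono) auto
    also have "\<dots> = c * C * (L / h) ^ Suc r * (outside_mass h a b (p - ?k) (q + ?k) + 2 * ?e)"
      unfolding power_divide outside_mass_def by (simp add: algebra_simps)
    also have "\<dots> \<le> c * C * (L / h) ^ Suc r * (2 * (outside_mass h a b (p - ?k) (q + ?k) + ?e))"
      using outside_mass_nonneg[of h a b "p - ?k" "q + ?k"] c C L h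
      by (intro mult_left_mono mult_nonneg_nonneg) auto
    also have "\<dots> = 2 * (c * C) * ((L / h) ^ Suc r * (outside_mass h a b (p - ?k) (q + ?k) + ?e))"
      by (simp only: mult_ac)
    also have "\<dots> \<le> (2 * (c * C) + 1) * ((L / h) ^ Suc r * (outside_mass h a b (p - ?k) (q + ?k) + ?e))"
      using outside_mass_nonneg[of h a b "p - ?k" "q + ?k"] L h
      by (intro mult_right_mono mult_nonneg_nonneg add_nonneg_nonneg) auto
    also have "\<dots> = (2 * (c * C) + 1) * (L / h) ^ Suc r * (outside_mass h a b (p - ?k) (q + ?k) + ?e)"
      by (simp only: mult.assoc)
    finally show "\<bar>interval_deriv (Suc r) h a b (p + y) (q + y)\<bar>
      \<le> (2 * (c * C) + 1) * (L / h) ^ Suc r * (outside_mass h a b (p - ?k) (q + ?k) + ?e)" .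
  qed
qed

lemma normal_measure_atMost:
  assumes s: "s > 0"
  shows "measure (density lborel (\<lambda>z. ennreal (normal_density x s z))) {..u} = normal_cdf ((u - x) / s)"
proof -
  have "emeasure (density lborel (\<lambda>z. ennreal (normal_density x s z))) {..u}
      = (\<integral>\<^sup>+z. ennreal (normal_density x s z) * indicator {..u} z \<partial>lborel)"
    by (subst emeasure_density) auto
  also have "\<dots> = ennreal \<bar>s\<bar> * (\<integral>\<^sup>+y. ennreal (normal_density x s (x + s * y)) * indicator {..u} (x + s * y) \<partial>lborel)"
    using s by (intro nn_integral_real_affine) auto
  also have "\<dots> = (\<integral>\<^sup>+y. ennreal \<bar>s\<bar> * (ennreal (normal_density x s (x + s * y)) * indicator {..u} (x + s * y)) \<partial>lborel)"
    by (rule nn_integral_cmult[symmetric]) auto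
  also have "\<dots> = (\<integral>\<^sup>+y. ennreal (std_normal_density y) * indicator {..(u - x) / s} y \<partial>lborel)"
  proof (rule nn_integral_cong)
    fix y
    have "s * normal_density x s (x + s * y) = std_normal_density y"
      using s by (simp add: normal_density_def real_sqrt_mult power_mult_distrib)
    then have "ennreal \<bar>s\<bar> * ennreal (normal_density x s (x + s * y)) = ennreal (std_normal_density y)"
      using s by (simp add: ennreal_mult'[symmetric])
    moreover have "indicator {..u} (x + s * y) = (indicator {..(u - x) / s} y :: ennreal)"
      using s by (auto simp: indicator_def field_simps)
    ultimately show "ennreal \<bar>s\<bar> * (ennreal (normal_density x s (x + s * y)) * indicator {..u} (x + s * y))
        = ennreal (std_normal_density y) * indicator {..(u - x) / s} y"
      by (simp add: mult.assoc[symmetric])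
  qed
  also have "\<dots> = emeasure (density lborel (\<lambda>x. ennreal (std_normal_density x))) {..(u - x) / s}"
    by (subst emeasure_density) auto
  finally show ?thesis by (simp add: measure_def normal_cdf_def)
qed

lemma normal_measure_lessThan:
  assumes s: "s > 0"
  shows "measure (density lborel (\<lambda>z. ennreal (normal_density x s z))) {..<u} = normal_cdf ((u - x) / s)"
proof -
  have "emeasure (density lborel (\<lambda>z. ennreal (normal_density x s z))) {..<u}
      = emeasure (density lborel (\<lambda>z. ennreal (normal_density x s z))) {..u}"
    using AE_lborel_singleton[of u]
    by (auto simp: emeasure_density intro!: nn_integral_cong_AE elim!: eventually_mono simp: indicator_def)
  then show ?thesis using normal_measure_atMost[OF s] by (simp add: measure_def)
qed

text \<open>
  The interval is given by the two inequalities that occur in \<open>m_fun\<close>, which make sense for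
  infinite ends as well; it is the difference of the sets \<open>U\<close> and \<open>V\<close>, one for each end.
\<close>

lemma nn_integral_normal_interval:
  assumes s: "s > 0" and e: "e > 0" and ab: "a \<le> b" and t: "t > 0"
  shows "(\<integral>\<^sup>+z. indicator {z. ereal (w + e * z) - b < ereal t \<and> a - ereal (w + e * z) < ereal t} z
           * ennreal (normal_density x s z) \<partial>lborel)
    = ennreal (interval_deriv 0 (e * s) a b (w + e * x - t) (w + e * x + t))"
proof -
  let ?N = "density lborel (\<lambda>z. ennreal (normal_density x s z))"
  interpret N: prob_space ?N by (rule prob_space_normal_density[OF s])
  define U where "U = {z. ereal (w + e * z) - b < ereal t}"
  define V where "V = {z. \<not> a - ereal (w + e * z) < ereal t}"
  have U: "measure ?N U = end_deriv 0 (e * s) b (w + e * x - t)" "U \<in> sets borel"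
  proof -
    have "measure ?N U = end_deriv 0 (e * s) b (w + e * x - t) \<and> U \<in> sets borel"
    proof (cases b)
      case (real b')
      have "U = {..<(b' + t - w) / e}" using e by (auto simp: U_def real field_simps)
      moreover have "((b' + t - w) / e - x) / s = (b' - (w + e * x - t)) / (e * s)"
        using e s by (simp add: field_simps)
      ultimately show ?thesis using normal_measure_lessThan[OF s] real by simp
    next
      case PInf
      then have "U = UNIV" by (simp add: U_def)
      then show ?thesis using N.prob_space PInf by simp
    next
      case MInf
      then have "U = {}" by (simp add: U_def)
      then show ?thesis using MInf by simp
    qed
    then show "measure ?N U = end_deriv 0 (e * s) b (w + e * x - t)" "U \<in> sets borel" by auto
  qed
  have V: "measure ?N V = end_deriv 0 (e * s) a (w + e * x + t)" "V \<in> sets borel"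
  proof -
    have "measure ?N V = end_deriv 0 (e * s) a (w + e * x + t) \<and> V \<in> sets borel"
    proof (cases a)
      case (real a')
      have "V = {..(a' - t - w) / e}" using e by (auto simp: V_def real field_simps)
      moreover have "((a' - t - w) / e - x) / s = (a' - (w + e * x + t)) / (e * s)"
        using e s by (simp add: field_simps)
      ultimately show ?thesis using normal_measure_atMost[OF s] real by simp
    next
      case PInf
      then have "V = UNIV" by (simp add: V_def)
      then show ?thesis using N.prob_space PInf by simp
    next
      case MInf
      then have "V = {}" by (simp add: V_def)
      then show ?thesis using MInf by simp
    qed
    then show "measure ?N V = end_deriv 0 (e * s) a (w + e * x + t)" "V \<in> sets borel" by auto
  qed
  have "V \<subseteq> U"
  proof
    fix z assume "z \<in> V"
    then show "z \<in> U" using ab t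
      by (cases a; cases b) (auto simp: U_def V_def)
  qed
  have "(\<integral>\<^sup>+z. indicator {z. ereal (w + e * z) - b < ereal t \<and> a - ereal (w + e * z) < ereal t} z
           * ennreal (normal_density x s z) \<partial>lborel) = emeasure ?N (U - V)"
    using U(2) V(2) by (subst emeasure_density) (auto simp: U_def V_def indicator_def intro!: nn_integral_cong)
  also have "\<dots> = ennreal (measure ?N U - measure ?N V)"
    using U(2) V(2) \<open>V \<subseteq> U\<close> by (simp add: N.emeasure_eq_measure N.finite_measure_Diff)
  finally show ?thesis by (simp add: U V interval_deriv_def)
qed

section \<open>Differentiating an average of products\<close>

lemma DERIV_integral_bounded:
  fixes f f' :: "'a \<Rightarrow> real \<Rightarrow> real"
  assumes "finite_measure M"
    and [measurable]: "\<And>t. (\<lambda>\<omega>. f \<omega> t) \<in> borel_measurable M"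
      "\<And>t. (\<lambda>\<omega>. f' \<omega> t) \<in> borel_measurable M"
    and D: "\<And>\<omega> t. \<omega> \<in> space M \<Longrightarrow> (f \<omega> has_real_derivative f' \<omega> t) (at t)"
    and B0: "\<And>\<omega> t. \<omega> \<in> space M \<Longrightarrow> \<bar>f \<omega> t\<bar> \<le> B0"
    and B: "\<And>\<omega> t. \<omega> \<in> space M \<Longrightarrow> \<bar>f' \<omega> t\<bar> \<le> B"
  shows "((\<lambda>t. \<integral>\<omega>. f \<omega> t \<partial>M) has_real_derivative (\<integral>\<omega>. f' \<omega> t \<partial>M)) (at t)"
proof -
  interpret finite_measure M by fact
  have int: "integrable M (\<lambda>\<omega>. f \<omega> t)" for t
    using B0 by (intro integrable_const_bound[where B = B0]) auto
  show ?thesis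
    unfolding DERIV_def LIMSEQ_SEQ_conv[symmetric]
  proof (intro allI impI)
    fix S :: "nat \<Rightarrow> real"
    assume S: "(\<forall>n. S n \<noteq> 0) \<and> S \<longlonglongrightarrow> 0"
    have eq: "(\<integral>\<omega>. f \<omega> (t + S n) \<partial>M) - (\<integral>\<omega>. f \<omega> t \<partial>M) = (\<integral>\<omega>. f \<omega> (t + S n) - f \<omega> t \<partial>M)" for n
      using int by simp
    have "(\<lambda>n. \<integral>\<omega>. (f \<omega> (t + S n) - f \<omega> t) / S n \<partial>M) \<longlonglongrightarrow> (\<integral>\<omega>. f' \<omega> t \<partial>M)"
    proof (rule integral_dominated_convergence[where w = "\<lambda>_. B"])
      show "AE \<omega> in M. (\<lambda>n. (f \<omega> (t + S n) - f \<omega> t) / S n) \<longlonglongrightarrow> f' \<omega> t"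
      proof (rule AE_I2)
        fix \<omega> assume "\<omega> \<in> space M"
        from D[OF this, of t] show "(\<lambda>n. (f \<omega> (t + S n) - f \<omega> t) / S n) \<longlonglongrightarrow> f' \<omega> t"
          unfolding DERIV_def LIMSEQ_SEQ_conv[symmetric] using S by blast
      qed
      show "AE \<omega> in M. norm ((f \<omega> (t + S n) - f \<omega> t) / S n) \<le> B" for n
      proof (rule AE_I2)
        fix \<omega> assume \<omega>: "\<omega> \<in> space M"
        have "norm (f \<omega> (t + S n) - f \<omega> t) \<le> B * norm (t + S n - t)"
          by (rule field_differentiable_bound[where S = UNIV and f' = "f' \<omega>"]) (use D[OF \<omega>] B[OF \<omega>] in auto)
        then show "norm ((f \<omega> (t + S n) - f \<omega> t) / S n) \<le> B"
          using S by (simp add: abs_divide divide_le_eq)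
      qed
    qed auto
    then show "(\<lambda>n. ((\<integral>\<omega>. f \<omega> (t + S n) \<partial>M) - (\<integral>\<omega>. f \<omega> t \<partial>M)) / S n) \<longlonglongrightarrow> (\<integral>\<omega>. f' \<omega> t \<partial>M)"
      unfolding eq by simp
  qed
qed

text \<open>
  A derivative in coordinate \<open>k\<close> acts on the factor \<open>k\<close> alone, and the bounds \<open>c\<close> justify
  differentiation under the integral.
\<close>

lemma partial_derivs_integral_prod:
  fixes F :: "nat \<Rightarrow> nat \<Rightarrow> 'a \<Rightarrow> real \<Rightarrow> real"
  assumes M: "finite_measure M"
    and meas: "\<And>r j t. j < d \<Longrightarrow> (\<lambda>\<omega>. F r j \<omega> t) \<in> borel_measurable M"
    and D: "\<And>r j \<omega> t. j < d \<Longrightarrow> (F r j \<omega> has_real_derivative F (Suc r) j \<omega> t) (at t)"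
    and c: "\<And>r j \<omega> t. j < d \<Longrightarrow> \<bar>F r j \<omega> t\<bar> \<le> c r"
    and \<rho>: "\<And>w. w \<in> carrier_vec d \<Longrightarrow> \<rho> w = (\<integral>\<omega>. (\<Prod>j<d. F 0 j \<omega> (vec_index w j)) \<partial>M)"
    and js: "set js \<subseteq> {..<d}" and w: "w \<in> carrier_vec d"
  shows "partial_derivs d js \<rho> w = (\<integral>\<omega>. (\<Prod>j<d. F (count_list js j) j \<omega> (vec_index w j)) \<partial>M)"
  using js w
proof (induction js arbitrary: w)
  case Nil
  then show ?case by (simp add: partial_derivs_def \<rho>)
next
  case (Cons k js)
  have k: "k < d" using Cons.prems by simp
  define n where "n = count_list js"
  define R where "R = (\<lambda>\<omega>. \<Prod>j\<in>{..<d} - {k}. F (n j) j \<omega> (vec_index w j))"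
  define f where "f = (\<lambda>r \<omega> t. F r k \<omega> (vec_index w k + t) * R \<omega>)"
  \<comment> \<open>\<open>f\<close> isolates the factor \<open>k\<close>, differentiated \<open>r\<close> times and with its argument moved by \<open>t\<close>\<close>
  have fR: "(\<Prod>j<d. F (if j = k then r else n j) j \<omega> (vec_index w j + (if j = k then t else 0))) = f r \<omega> t" for r \<omega> t
    unfolding f_def R_def using k by (subst prod.remove[of _ k]) (auto intro!: prod.cong)
  have Rb: "\<bar>R \<omega>\<bar> \<le> (\<Prod>j\<in>{..<d} - {k}. c (n j))" for \<omega>
    unfolding R_def abs_prod by (intro prod_mono) (auto intro: c)
  have fb: "\<bar>f r \<omega> t\<bar> \<le> c r * (\<Prod>j\<in>{..<d} - {k}. c (n j))" for r \<omega> t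
    unfolding f_def abs_mult using order_trans[OF abs_ge_zero c[OF k]]
    by (intro mult_mono c k Rb) auto
  have Rm: "R \<in> borel_measurable M"
    unfolding R_def by (intro borel_measurable_prod meas) auto
  have fm: "(\<lambda>\<omega>. f r \<omega> t) \<in> borel_measurable M" for r t
    unfolding f_def by (intro borel_measurable_times meas k Rm)
  have fD: "(f r \<omega> has_real_derivative f (Suc r) \<omega> t) (at t)" for r \<omega> t
  proof -
    have "((\<lambda>t. vec_index w k + t) has_real_derivative 1) (at t)"
      by (auto intro!: derivative_eq_intros)
    from DERIV_chain2[OF D[OF k] this]
    have "((\<lambda>t. F r k \<omega> (vec_index w k + t)) has_real_derivative F (Suc r) k \<omega> (vec_index w k + t)) (at t)"
      by simp
    then show ?thesis unfolding f_def by (rule DERIV_cmult_right)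
  qed
  have shift: "partial_derivs d js \<rho> (w + t \<cdot>\<^sub>v unit_vec d k) = (\<integral>\<omega>. f (n k) \<omega> t \<partial>M)" for t
  proof -
    have "partial_derivs d js \<rho> (w + t \<cdot>\<^sub>v unit_vec d k)
        = (\<integral>\<omega>. (\<Prod>j<d. F (n j) j \<omega> (vec_index (w + t \<cdot>\<^sub>v unit_vec d k) j)) \<partial>M)"
      unfolding n_def using Cons.prems by (intro Cons.IH) auto
    also have "\<dots> = (\<integral>\<omega>. (\<Prod>j<d. F (if j = k then n k else n j) j \<omega> (vec_index w j + (if j = k then t else 0))) \<partial>M)"
      using Cons.prems k by (intro Bochner_Integration.integral_cong prod.cong refl) auto
    finally show ?thesis unfolding fR .
  qed
  have "((\<lambda>t. \<integral>\<omega>. f (n k) \<omega> t \<partial>M) has_real_derivative (\<integral>\<omega>. f (Suc (n k)) \<omega> 0 \<partial>M)) (at 0)"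
    by (rule DERIV_integral_bounded[OF M fm fm fD fb fb])
  then have "partial_derivs d (k # js) \<rho> w = (\<integral>\<omega>. f (Suc (n k)) \<omega> 0 \<partial>M)"
    by (simp add: partial_derivs_def partial_deriv_def shift[unfolded partial_derivs_def] DERIV_imp_deriv)
  also have "\<dots> = (\<integral>\<omega>. (\<Prod>j<d. F (count_list (k # js) j) j \<omega> (vec_index w j)) \<partial>M)"
    unfolding fR[symmetric] by (intro Bochner_Integration.integral_cong prod.cong refl) (auto simp: n_def)
  finally show ?case .
qed


section \<open>Sums over index tuples\<close>

lemma sum_index_tuples_Suc:
  "(\<Sum>js\<in>index_tuples d (Suc v). f js) = (\<Sum>js\<in>index_tuples d v. \<Sum>j<d. f (j # js))"
proof -
  have "index_tuples d (Suc v) = (\<lambda>(js, j). j # js) ` (index_tuples d v \<times> {..<d})"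
    by (auto simp: index_tuples_def length_Suc_conv image_iff)
  moreover have "inj_on (\<lambda>(js, j). j # js) (index_tuples d v \<times> {..<d})"
    by (auto simp: inj_on_def)
  ultimately have "(\<Sum>js\<in>index_tuples d (Suc v). f js) = (\<Sum>(js, j)\<in>index_tuples d v \<times> {..<d}. f (j # js))"
    by (simp add: sum.reindex case_prod_unfold)
  then show ?thesis by (simp add: sum.cartesian_product)
qed

text \<open>
  Prepending an index \<open>j\<close> to a tuple multiplies the product by \<open>u j\<close> if \<open>j\<close> is new, and by 1 if
  \<open>j\<close> is one of the at most \<open>v\<close> indices already present.
\<close>

lemma sum_index_tuples_prod_set_le:
  fixes u :: "nat \<Rightarrow> real"
  assumes u: "\<And>j. j < d \<Longrightarrow> 0 \<le> u j"
  shows "(\<Sum>js\<in>index_tuples d v. \<Prod>j\<in>set js. u j) \<le> (real v + (\<Sum>j<d. u j)) ^ v"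
proof (induction v)
  case 0
  have "index_tuples d 0 = {[]}" by (auto simp: index_tuples_def)
  then show ?case by simp
next
  case (Suc v)
  let ?U = "\<Sum>j<d. u j"
  have U: "?U \<ge> 0" using u by (auto intro: sum_nonneg)
  have "(\<Sum>j<d. \<Prod>i\<in>set (j # js). u i) \<le> (real v + ?U) * (\<Prod>i\<in>set js. u i)"
    if js: "js \<in> index_tuples d v" for js
  proof -
    have nonneg: "0 \<le> (\<Prod>i\<in>set js. u i)"
      using js u by (intro prod_nonneg) (auto simp: index_tuples_def)
    have "(\<Sum>j<d. \<Prod>i\<in>set (j # js). u i) \<le> (\<Sum>j<d. ((if j \<in> set js then 1 else 0) + u j) * (\<Prod>i\<in>set js. u i))"
    proof (rule sum_mono)
      fix j assume "j \<in> {..<d}"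
      then show "(\<Prod>i\<in>set (j # js). u i) \<le> ((if j \<in> set js then 1 else 0) + u j) * (\<Prod>i\<in>set js. u i)"
        using nonneg u by (cases "j \<in> set js") (auto simp: insert_absorb distrib_right)
    qed
    also have "\<dots> = (real (card (set js \<inter> {..<d})) + ?U) * (\<Prod>i\<in>set js. u i)"
      by (simp add: sum_distrib_right[symmetric] sum.distrib sum.If_cases Int_commute)
    also have "\<dots> \<le> (real v + ?U) * (\<Prod>i\<in>set js. u i)"
    proof (intro mult_right_mono nonneg add_right_mono)
      have "card (set js \<inter> {..<d}) \<le> card (set js)" by (intro card_mono) auto
      also have "\<dots> \<le> v" using js card_length[of js] by (simp add: index_tuples_def)
      finally show "real (card (set js \<inter> {..<d})) \<le> real v" by simp
    qed
    finally show ?thesis .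
  qed
  then have "(\<Sum>js\<in>index_tuples d (Suc v). \<Prod>j\<in>set js. u j)
      \<le> (\<Sum>js\<in>index_tuples d v. (real v + ?U) * (\<Prod>i\<in>set js. u i))"
    unfolding sum_index_tuples_Suc by (rule sum_mono)
  also have "\<dots> = (real v + ?U) * (\<Sum>js\<in>index_tuples d v. \<Prod>i\<in>set js. u i)"
    by (simp add: sum_distrib_left)
  also have "\<dots> \<le> (real (Suc v) + ?U) * (real (Suc v) + ?U) ^ v"
  proof (rule mult_mono)
    have "(real v + ?U) ^ v \<le> (real (Suc v) + ?U) ^ v"
      using U by (intro power_mono) auto
    with Suc show "(\<Sum>js\<in>index_tuples d v. \<Prod>j\<in>set js. u j) \<le> (real (Suc v) + ?U) ^ v" by linarith
    show "0 \<le> (\<Sum>js\<in>index_tuples d v. \<Prod>j\<in>set js. u j)"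
      using u by (intro sum_nonneg prod_nonneg) (auto simp: index_tuples_def)
  qed (use U in auto)
  finally show ?case by simp
qed

text \<open>
  The number \<open>G r j\<close> stands for the factor \<open>j\<close> differentiated \<open>r\<close> times.  The bounds on
  \<open>G 0\<close> force \<open>\<theta> j \<le> 1\<close>, hence \<open>1 \<le> exp 1 * exp (- \<theta> j)\<close>.  So each differentiated factor can be given the weight \<open>exp (- \<theta> j)\<close>
  too, at the cost of a constant, so that these weights combine to the exponential of the full sum.
\<close>

lemma prod_count_list_le:
  fixes G :: "nat \<Rightarrow> nat \<Rightarrow> real" and \<theta> :: "nat \<Rightarrow> real"
  assumes js: "js \<in> index_tuples d v"
    and \<theta>: "\<And>j. j < d \<Longrightarrow> 0 \<le> \<theta> j" and C: "C \<ge> 1" and \<Lambda>: "\<Lambda> \<ge> 0" and e: "e \<ge> 0"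
    and G0: "\<And>j. j < d \<Longrightarrow> 0 \<le> G 0 j" "\<And>j. j < d \<Longrightarrow> G 0 j \<le> 1 - \<theta> j"
    and G: "\<And>r j. j < d \<Longrightarrow> r < v \<Longrightarrow> \<bar>G (Suc r) j\<bar> \<le> C * \<Lambda> ^ Suc r * (\<theta> j + e)"
  shows "(\<Prod>j<d. \<bar>G (count_list js j) j\<bar>)
    \<le> (C * exp 1) ^ v * \<Lambda> ^ v * exp (- (\<Sum>j<d. \<theta> j)) * (\<Prod>j\<in>set js. \<theta> j + e)"
proof -
  have len: "length js = v" and sub: "set js \<subseteq> {..<d}" using js by (auto simp: index_tuples_def)
  let ?D = "{..<d}" and ?J = "set js"
  have J: "(\<Prod>j\<in>?J. \<bar>G (count_list js j) j\<bar>)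
      \<le> (\<Prod>j\<in>?J. C * exp 1 * \<Lambda> ^ count_list js j * exp (- \<theta> j) * (\<theta> j + e))"
  proof (rule prod_mono, intro conjI abs_ge_zero)
    fix j assume j: "j \<in> ?J"
    then have jd: "j < d" using sub by auto
    have "count_list js j \<noteq> 0" using j by (simp add: count_list_0_iff)
    then obtain r where r: "count_list js j = Suc r" using not0_implies_Suc by blast
    have "count_list js j \<le> v" using count_le_length[of js j] len by simp
    then have rv: "r < v" using r by simp
    have "\<theta> j \<le> 1" using G0[OF jd] by linarith
    then have ex: "1 \<le> exp 1 * exp (- \<theta> j)" by (simp add: exp_add[symmetric])
    have nonneg: "0 \<le> C * \<Lambda> ^ Suc r * (\<theta> j + e)"
      using C \<Lambda> e \<theta>[OF jd] by (intro mult_nonneg_nonneg) auto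
    have "\<bar>G (count_list js j) j\<bar> \<le> 1 * (C * \<Lambda> ^ Suc r * (\<theta> j + e))"
      using G[OF jd rv] r by simp
    also have "\<dots> \<le> exp 1 * exp (- \<theta> j) * (C * \<Lambda> ^ Suc r * (\<theta> j + e))"
      by (rule mult_right_mono[OF ex nonneg])
    finally show "\<bar>G (count_list js j) j\<bar> \<le> C * exp 1 * \<Lambda> ^ count_list js j * exp (- \<theta> j) * (\<theta> j + e)"
      unfolding r by (simp only: mult_ac)
  qed
  have N: "(\<Prod>j\<in>?D - ?J. \<bar>G (count_list js j) j\<bar>) \<le> (\<Prod>j\<in>?D - ?J. exp (- \<theta> j))"
  proof (rule prod_mono, intro conjI abs_ge_zero)
    fix j assume j: "j \<in> ?D - ?J"
    then have "count_list js j = 0" by (simp add: count_list_0_iff)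
    then show "\<bar>G (count_list js j) j\<bar> \<le> exp (- \<theta> j)"
      using G0[of j] j exp_ge_add_one_self[of "- \<theta> j"] by simp
  qed
  have "(\<Prod>j<d. \<bar>G (count_list js j) j\<bar>)
      = (\<Prod>j\<in>?D - ?J. \<bar>G (count_list js j) j\<bar>) * (\<Prod>j\<in>?J. \<bar>G (count_list js j) j\<bar>)"
    by (rule prod.subset_diff[OF sub]) simp
  also have "\<dots> \<le> (\<Prod>j\<in>?D - ?J. exp (- \<theta> j))
      * (\<Prod>j\<in>?J. C * exp 1 * \<Lambda> ^ count_list js j * exp (- \<theta> j) * (\<theta> j + e))"
    by (intro mult_mono N J prod_nonneg) auto
  also have "\<dots> = ((\<Prod>j\<in>?D - ?J. exp (- \<theta> j)) * (\<Prod>j\<in>?J. exp (- \<theta> j)))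
      * (C * exp 1) ^ card ?J * (\<Prod>j\<in>?J. \<Lambda> ^ count_list js j) * (\<Prod>j\<in>?J. \<theta> j + e)"
    by (simp add: prod.distrib)
  also have "(\<Prod>j\<in>?D - ?J. exp (- \<theta> j)) * (\<Prod>j\<in>?J. exp (- \<theta> j)) = exp (- (\<Sum>j<d. \<theta> j))"
    using prod.subset_diff[OF sub, of "\<lambda>j. exp (- \<theta> j)"] by (simp add: exp_sum sum_negf[symmetric])
  also have "(\<Prod>j\<in>?J. \<Lambda> ^ count_list js j) = \<Lambda> ^ v"
    by (simp add: power_sum[symmetric] sum_count_set[of js] len)
  also have "exp (- (\<Sum>j<d. \<theta> j)) * (C * exp 1) ^ card ?J * \<Lambda> ^ v * (\<Prod>j\<in>?J. \<theta> j + e)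
     \<le> exp (- (\<Sum>j<d. \<theta> j)) * (C * exp 1) ^ v * \<Lambda> ^ v * (\<Prod>j\<in>?J. \<theta> j + e)"
  proof (intro mult_right_mono mult_left_mono power_increasing)
    show "card ?J \<le> v" using card_length[of js] len by simp
    show "1 \<le> C * exp 1" using C mult_mono[of 1 C 1 "exp 1"] by simp
    show "0 \<le> (\<Prod>j\<in>?J. \<theta> j + e)" using \<theta> e sub by (intro prod_nonneg) auto
  qed (use \<Lambda> in auto)
  finally show ?thesis by (simp only: mult_ac)
qed

section \<open>Smoothed rectangle indicators as averages of products\<close>

text \<open>
  The levels \<open>u\<close> in the unit interval with \<open>X < u / \<phi>\<close> form an interval of length
  \<open>g_ext \<phi> X\<close>.
\<close>

lemma g_ext_eq_nn_integral:
  assumes \<phi>: "\<phi> > 0"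
  shows "ennreal (g_ext \<phi> X) = (\<integral>\<^sup>+u. indicator {0<..<1} u * indicator {u. X < ereal (u / \<phi>)} u \<partial>lborel)"
proof (cases X)
  case PInf
  then show ?thesis by (simp add: g_ext_def)
next
  case MInf
  then show ?thesis by (simp add: g_ext_def)
next
  case (real t)
  have "(\<integral>\<^sup>+u. indicator {0<..<1} u * indicator {u. X < ereal (u / \<phi>)} u \<partial>lborel)
      = (\<integral>\<^sup>+u. indicator {max 0 (\<phi> * t)<..<1} u \<partial>lborel)"
    using \<phi> by (intro nn_integral_cong) (auto simp: real indicator_def field_simps)
  also have "\<dots> = ennreal (g_ext \<phi> X)"
  proof (cases "\<phi> * t \<le> 1")
    case True
    then have "emeasure lborel {max 0 (\<phi> * t)<..<1} = ennreal (1 - max 0 (\<phi> * t))"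
      by simp
    also have "1 - max 0 (\<phi> * t) = g_ext \<phi> X"
      using True \<phi> by (auto simp: g_ext_def g_fun_def real field_simps max_def mult_le_0_iff zero_le_mult_iff)
    finally show ?thesis by simp
  next
    case False
    then have "{max 0 (\<phi> * t)<..<1} = {}" by auto
    moreover have "t > 0"
      using False \<phi> zero_less_mult_pos[of \<phi> t] by simp
    then have "g_ext \<phi> X = 0"
      using False \<phi> by (simp add: g_ext_def g_fun_def real field_simps)
    ultimately show ?thesis by simp
  qed
  finally show ?thesis by simp
qed

definition in_layer :: "real \<Rightarrow> ereal \<Rightarrow> ereal \<Rightarrow> real \<Rightarrow> real \<Rightarrow> ennreal" where
  "in_layer \<phi> a b u y = (if ereal y - b < ereal (u / \<phi>) \<and> a - ereal y < ereal (u / \<phi>) then 1 else 0)"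

text \<open>
  A maximum lies below a level iff all its entries do, so the indicator of the level set
  factorizes over the coordinates.
\<close>

lemma m_fun_eq_nn_integral:
  assumes \<phi>: "\<phi> > 0" and d: "d > 0"
  shows "ennreal (m_fun d (a, b) \<phi> w)
    = (\<integral>\<^sup>+u. indicator {0<..<1} u * (\<Prod>j<d. in_layer \<phi> (a j) (b j) u (vec_index w j)) \<partial>lborel)"
proof -
  have "indicator {u. Max ((\<lambda>j. max (ereal (vec_index w j) - b j) (a j - ereal (vec_index w j))) ` {..<d}) < ereal (u / \<phi>)} u
      = (\<Prod>j<d. in_layer \<phi> (a j) (b j) u (vec_index w j))" for u
  proof -
    have "Max ((\<lambda>j. max (ereal (vec_index w j) - b j) (a j - ereal (vec_index w j))) ` {..<d}) < ereal (u / \<phi>)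
        \<longleftrightarrow> (\<forall>j<d. ereal (vec_index w j) - b j < ereal (u / \<phi>) \<and> a j - ereal (vec_index w j) < ereal (u / \<phi>))"
      using d by (subst Max_less_iff) auto
    moreover have "(\<Prod>j<d. in_layer \<phi> (a j) (b j) u (vec_index w j))
        = (if \<forall>j<d. ereal (vec_index w j) - b j < ereal (u / \<phi>) \<and> a j - ereal (vec_index w j) < ereal (u / \<phi>) then 1 else 0)"
    proof (cases "\<forall>j<d. ereal (vec_index w j) - b j < ereal (u / \<phi>) \<and> a j - ereal (vec_index w j) < ereal (u / \<phi>)")
      case True
      then have "(\<Prod>j<d. in_layer \<phi> (a j) (b j) u (vec_index w j)) = (\<Prod>j<d. 1)"
        by (intro prod.cong) (auto simp: in_layer_def)
      then show ?thesis using True by simp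
    next
      case False
      then obtain j where "j < d" "in_layer \<phi> (a j) (b j) u (vec_index w j) = 0"
        by (auto simp: in_layer_def)
      then have "(\<Prod>j<d. in_layer \<phi> (a j) (b j) u (vec_index w j)) = 0"
        by (intro prod_zero) auto
      then show ?thesis unfolding if_not_P[OF False] .
    qed
    ultimately show ?thesis by (simp add: indicator_def)
  qed
  then show ?thesis
    unfolding m_fun_def prod.case g_ext_eq_nn_integral[OF \<phi>] by (simp only:)
qed

lemma g_ext_nonneg: "\<phi> > 0 \<Longrightarrow> 0 \<le> g_ext \<phi> X"
  by (auto simp: g_ext_def g_fun_def field_simps)

lemma m_fun_nonneg: "\<phi> > 0 \<Longrightarrow> 0 \<le> m_fun d A \<phi> w"
  by (auto simp: m_fun_def g_ext_nonneg split: prod.split)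

lemma measurable_in_layer [measurable]:
  assumes [measurable]: "f \<in> borel_measurable M" "g \<in> borel_measurable M"
  shows "(\<lambda>x. in_layer \<phi> a b (f x) (g x)) \<in> borel_measurable M"
  unfolding in_layer_def by measurable

lemma nn_integral_in_layer:
  assumes "s > 0" "e > 0" "\<phi> > 0" "a \<le> b" "u > 0"
  shows "(\<integral>\<^sup>+z. in_layer \<phi> a b u (w + e * z) * ennreal (normal_density x s z) \<partial>lborel)
    = ennreal (interval_deriv 0 (e * s) a b (e * x - u / \<phi> + w) (e * x + u / \<phi> + w))"
proof -
  have "(\<integral>\<^sup>+z. in_layer \<phi> a b u (w + e * z) * ennreal (normal_density x s z) \<partial>lborel)
    = (\<integral>\<^sup>+z. indicator {z. ereal (w + e * z) - b < ereal (u / \<phi>) \<and> a - ereal (w + e * z) < ereal (u / \<phi>)} z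
           * ennreal (normal_density x s z) \<partial>lborel)"
    by (intro nn_integral_cong) (simp add: in_layer_def indicator_def)
  also have "\<dots> = ennreal (interval_deriv 0 (e * s) a b (w + e * x - u / \<phi>) (w + e * x + u / \<phi>))"
    using assms by (intro nn_integral_normal_interval) auto
  also have "w + e * x - u / \<phi> = e * x - u / \<phi> + w" by simp
  also have "w + e * x + u / \<phi> = e * x + u / \<phi> + w" by simp
  finally show ?thesis .
qed

text \<open>
  The pair \<open>\<omega>\<close> consists of the centre \<open>x\<close> of the isotropic Gaussian law and of the level \<open>u\<close>.
  Once both are fixed, the coordinates are independent and the indicator is a product.  The law \<open>M\<close>
  gives mass 1 to \<open>0 < u < 1\<close>; writing \<open>\<bar>u\<bar>\<close> makes the factors nonnegative at every \<open>\<omega>\<close>,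
  which allows pointwise estimates without an exceptional null set.
\<close>

lemma rho_fun_mixture:
  assumes S: "S \<in> carrier_mat d d" "transpose_mat S = S" "positive_definite d S"
    and s: "s > 0" "\<And>z. \<exists>i<d. z i \<noteq> 0 \<Longrightarrow> s\<^sup>2 * (\<Sum>i<d. (z i)\<^sup>2) < qform d S z"
    and \<phi>: "\<phi> > 0" and e: "e > 0" and d: "d > 0" and ab: "\<And>j. j < d \<Longrightarrow> a j \<le> b j"
  obtains M :: "((nat \<Rightarrow> real) \<times> real) measure"
  where "prob_space M" "sets M = sets (Pi\<^sub>M {..<d} (\<lambda>_. lborel) \<Otimes>\<^sub>M lborel)"
    "\<And>w. w \<in> carrier_vec d \<Longrightarrow> rho_fun d (a, b) \<phi> e S w
       = (\<integral>\<omega>. (\<Prod>j<d. interval_deriv 0 (e * s) (a j) (b j)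
            (e * fst \<omega> j - \<bar>snd \<omega>\<bar> / \<phi> + vec_index w j) (e * fst \<omega> j + \<bar>snd \<omega>\<bar> / \<phi> + vec_index w j)) \<partial>M)"
proof -
  let ?P = "Pi\<^sub>M {..<d} (\<lambda>_. lborel :: real measure)"
  let ?Q = "?P \<Otimes>\<^sub>M (lborel :: real measure)"
  interpret product_sigma_finite "\<lambda>_::nat. lborel :: real measure"
    by standard
  interpret P: finite_product_sigma_finite "\<lambda>_::nat. lborel :: real measure" "{..<d}"
    by standard auto
  interpret PP: pair_sigma_finite ?P ?P by standard
  interpret PL: pair_sigma_finite ?P "lborel :: real measure" by standard
  obtain b' :: "(nat \<Rightarrow> real) \<Rightarrow> ennreal" where b'[measurable]: "b' \<in> borel_measurable ?P"
    and b'1: "(\<integral>\<^sup>+x. b' x \<partial>?P) = 1"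
    and dens: "\<And>z. ennreal (exp (- scalar_prod (vec d z) (the (mat_inverse S) *\<^sub>v vec d z) / 2)
                / sqrt ((2 * pi) ^ d * Determinant.det S))
             = (\<integral>\<^sup>+x. b' x * (\<Prod>j<d. ennreal (normal_density (x j) s (z j))) \<partial>?P)"
    by (rule gaussian_density_mixture[OF S s(1)]) (use s(2) in blast)+
  define q where "q = (\<lambda>\<omega> :: (nat \<Rightarrow> real) \<times> real. b' (fst \<omega>) * indicator {0<..<1} (snd \<omega>))"
  have q[measurable]: "q \<in> borel_measurable ?Q" unfolding q_def by measurable
  define M where "M = density ?Q q"
  have "(\<integral>\<^sup>+\<omega>. q \<omega> \<partial>?Q) = (\<integral>\<^sup>+x. (\<integral>\<^sup>+u. q (x, u) \<partial>lborel) \<partial>?P)"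
    by (rule lborel.nn_integral_fst[symmetric]) measurable
  also have "\<dots> = 1"
    by (simp add: q_def nn_integral_cmult b'1)
  finally have q1: "(\<integral>\<^sup>+\<omega>. q \<omega> \<partial>?Q) = 1" .
  have prob: "prob_space M"
  proof
    have "emeasure M (space M) = (\<integral>\<^sup>+\<omega>. q \<omega> * indicator (space ?Q) \<omega> \<partial>?Q)"
      unfolding M_def space_density by (rule emeasure_density[OF q sets.top])
    also have "\<dots> = (\<integral>\<^sup>+\<omega>. q \<omega> \<partial>?Q)"
      by (intro nn_integral_cong) (auto simp: indicator_def)
    finally show "emeasure M (space M) = 1" using q1 by simp
  qed
  define k where "k = (\<lambda>z x. \<Prod>j<d. ennreal (normal_density (x j) s (z j)))"
  have k2[measurable]: "(\<lambda>(x, z). k z x) \<in> borel_measurable (?P \<Otimes>\<^sub>M ?P)"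
    unfolding k_def normal_density_def by measurable
  have k1[measurable]: "(\<lambda>x. k z x) \<in> borel_measurable ?P" "(\<lambda>z. k z x) \<in> borel_measurable ?P" for x z
    unfolding k_def normal_density_def by measurable
  have k3[measurable]: "(\<lambda>(z, x). k z x) \<in> borel_measurable (?P \<Otimes>\<^sub>M ?P)"
    unfolding k_def normal_density_def by measurable
  have dens_k: "ennreal (exp (- scalar_prod (vec d z) (the (mat_inverse S) *\<^sub>v vec d z) / 2)
                / sqrt ((2 * pi) ^ d * Determinant.det S)) = (\<integral>\<^sup>+x. b' x * k z x \<partial>?P)" for z
    by (simp only: dens k_def)
  have f_meas: "(\<lambda>z. ennreal (exp (- scalar_prod (vec d z) (the (mat_inverse S) *\<^sub>v vec d z) / 2)
                / sqrt ((2 * pi) ^ d * Determinant.det S))) \<in> borel_measurable ?P"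
    unfolding dens_k by measurable
  define F where "F = (\<lambda>j \<omega> t. interval_deriv 0 (e * s) (a j) (b j)
            (e * fst \<omega> j - \<bar>snd \<omega>\<bar> / \<phi> + t) (e * fst \<omega> j + \<bar>snd \<omega>\<bar> / \<phi> + t))"
  have es: "e * s > 0" using e s by simp
  have F_meas: "(\<lambda>\<omega>. F j \<omega> t) \<in> borel_measurable ?Q" if "j < d" for j t
  proof -
    have "(\<lambda>x. x j) \<in> borel_measurable ?P"
      using measurable_component_singleton[of j "{..<d}" "\<lambda>_. lborel"] that by simp
    then have [measurable]: "(\<lambda>\<omega> :: (nat \<Rightarrow> real) \<times> real. fst \<omega> j) \<in> borel_measurable ?Q"
      by (rule measurable_compose[OF measurable_fst])
    show ?thesis
      unfolding F_def interval_deriv_def using measurable_end_deriv[OF es] by measurable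
  qed
  have F_nonneg: "0 \<le> F j \<omega> t" if "j < d" for j \<omega> t
    unfolding F_def using ab[OF that] es \<phi> by (intro interval_deriv_0_nonneg) auto
  have rho: "rho_fun d (a, b) \<phi> e S w = (\<integral>\<omega>. (\<Prod>j<d. F j \<omega> (vec_index w j)) \<partial>M)"
    if w: "w \<in> carrier_vec d" for w
  proof -
    let ?m = "\<lambda>z. m_fun d (a, b) \<phi> (w + e \<cdot>\<^sub>v vec d z)"
    let ?J = "\<lambda>z u. \<Prod>j<d. in_layer \<phi> (a j) (b j) u (vec_index w j + e * z j)"
    have m: "ennreal (?m z) = (\<integral>\<^sup>+u. indicator {0<..<1} u * ?J z u \<partial>lborel)" for z
      unfolding m_fun_eq_nn_integral[OF \<phi> d]
      using w by (intro nn_integral_cong arg_cong2[where f = "(*)"] refl prod.cong) auto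
    have J1[measurable]: "(\<lambda>(z, u). ?J z u) \<in> borel_measurable ?Q"
      unfolding case_prod_unfold
      by (intro borel_measurable_prod_ennreal measurable_in_layer borel_measurable_add borel_measurable_times
          measurable_compose[OF measurable_fst measurable_component_singleton, of _ _ _ borel]) auto
    have J2[measurable]: "(\<lambda>z. ?J z u) \<in> borel_measurable ?P" for u
      by (intro borel_measurable_prod_ennreal measurable_in_layer borel_measurable_add borel_measurable_times) auto
    have m_meas[measurable]: "(\<lambda>z. ennreal (?m z)) \<in> borel_measurable ?P"
      unfolding m by measurable
    have "(\<lambda>z. enn2real (ennreal (?m z))) \<in> borel_measurable ?P" by measurable
    then have m_meas': "?m \<in> borel_measurable ?P"
      using m_fun_nonneg[OF \<phi>] by simp
    have inner: "(\<integral>\<^sup>+z. k z x * ennreal (?m z) \<partial>?P)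
        = (\<integral>\<^sup>+u. indicator {0<..<1} u * (\<Prod>j<d. ennreal (F j (x, u) (vec_index w j))) \<partial>lborel)" for x
    proof -
      have "(\<integral>\<^sup>+z. k z x * ennreal (?m z) \<partial>?P)
          = (\<integral>\<^sup>+z. (\<integral>\<^sup>+u. k z x * (indicator {0<..<1} u * ?J z u) \<partial>lborel) \<partial>?P)"
        unfolding m by (intro nn_integral_cong nn_integral_cmult[symmetric]) measurable
      also have "\<dots> = (\<integral>\<^sup>+u. (\<integral>\<^sup>+z. k z x * (indicator {0<..<1} u * ?J z u) \<partial>?P) \<partial>lborel)"
        by (rule PL.Fubini'[symmetric]) measurable
      also have "\<dots> = (\<integral>\<^sup>+u. indicator {0<..<1} u * (\<Prod>j<d. ennreal (F j (x, u) (vec_index w j))) \<partial>lborel)"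
      proof (rule nn_integral_cong)
        fix u :: real
        have "(\<integral>\<^sup>+z. k z x * (indicator {0<..<1} u * ?J z u) \<partial>?P)
            = (\<integral>\<^sup>+z. indicator {0<..<1} u * (\<Prod>j<d. in_layer \<phi> (a j) (b j) u (vec_index w j + e * z j)
                * ennreal (normal_density (x j) s (z j))) \<partial>?P)"
          by (intro nn_integral_cong) (simp add: k_def prod.distrib mult_ac)
        also have "\<dots> = indicator {0<..<1} u * (\<integral>\<^sup>+z. (\<Prod>j<d. in_layer \<phi> (a j) (b j) u (vec_index w j + e * z j)
                * ennreal (normal_density (x j) s (z j))) \<partial>?P)"
          by (intro nn_integral_cmult borel_measurable_prod_ennreal borel_measurable_times_ennreal measurable_in_layer
              borel_measurable_add borel_measurable_times) auto
        also have "(\<integral>\<^sup>+z. (\<Prod>j<d. in_layer \<phi> (a j) (b j) u (vec_index w j + e * z j)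
                * ennreal (normal_density (x j) s (z j))) \<partial>?P)
            = (\<Prod>j<d. \<integral>\<^sup>+y. in_layer \<phi> (a j) (b j) u (vec_index w j + e * y)
                * ennreal (normal_density (x j) s y) \<partial>lborel)"
          by (rule product_nn_integral_prod) auto
        also have "indicator {0<..<1} u * \<dots> = indicator {0<..<1} u * (\<Prod>j<d. ennreal (F j (x, u) (vec_index w j)))"
        proof (cases "0 < u")
          case True
          then show ?thesis
            using s(1) e \<phi> ab by (simp add: nn_integral_in_layer F_def)
        qed (simp add: indicator_def)
        finally show "(\<integral>\<^sup>+z. k z x * (indicator {0<..<1} u * ?J z u) \<partial>?P)
            = indicator {0<..<1} u * (\<Prod>j<d. ennreal (F j (x, u) (vec_index w j)))" .
      qed
      finally show ?thesis .
    qed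
    have G_meas[measurable]: "(\<lambda>\<omega>. \<Prod>j<d. ennreal (F j \<omega> (vec_index w j))) \<in> borel_measurable ?Q"
      using F_meas by (intro borel_measurable_prod_ennreal) auto
    have "(\<integral>\<^sup>+z. ennreal (?m z) \<partial>normal_law d S)
        = (\<integral>\<^sup>+z. (\<integral>\<^sup>+x. b' x * k z x \<partial>?P) * ennreal (?m z) \<partial>?P)"
      unfolding normal_law_def dens_k by (rule nn_integral_density[OF f_meas[unfolded dens_k] m_meas])
    also have "\<dots> = (\<integral>\<^sup>+z. (\<integral>\<^sup>+x. b' x * k z x * ennreal (?m z) \<partial>?P) \<partial>?P)"
      by (intro nn_integral_cong nn_integral_multc[symmetric]) measurable
    also have "\<dots> = (\<integral>\<^sup>+x. (\<integral>\<^sup>+z. b' x * k z x * ennreal (?m z) \<partial>?P) \<partial>?P)"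
      by (rule PP.Fubini') measurable
    also have "\<dots> = (\<integral>\<^sup>+x. b' x * (\<integral>\<^sup>+z. k z x * ennreal (?m z) \<partial>?P) \<partial>?P)"
      unfolding mult.assoc by (intro nn_integral_cong nn_integral_cmult) measurable
    also have "\<dots> = (\<integral>\<^sup>+x. (\<integral>\<^sup>+u. b' x * (indicator {0<..<1} u * (\<Prod>j<d. ennreal (F j (x, u) (vec_index w j)))) \<partial>lborel) \<partial>?P)"
      unfolding inner
    proof (intro nn_integral_cong nn_integral_cmult[symmetric])
      fix x assume "x \<in> space ?P"
      then show "(\<lambda>u. indicator {0<..<1} u * (\<Prod>j<d. ennreal (F j (x, u) (vec_index w j)))) \<in> borel_measurable lborel"
        using measurable_Pair2[OF G_meas] by (intro borel_measurable_times_ennreal) auto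
    qed
    also have "\<dots> = (\<integral>\<^sup>+x. (\<integral>\<^sup>+u. q (x, u) * (\<Prod>j<d. ennreal (F j (x, u) (vec_index w j))) \<partial>lborel) \<partial>?P)"
      by (simp add: q_def mult.assoc)
    also have "\<dots> = (\<integral>\<^sup>+\<omega>. q \<omega> * (\<Prod>j<d. ennreal (F j \<omega> (vec_index w j))) \<partial>?Q)"
      by (rule lborel.nn_integral_fst[of "\<lambda>\<omega>. q \<omega> * (\<Prod>j<d. ennreal (F j \<omega> (vec_index w j)))"]) measurable
    also have "\<dots> = (\<integral>\<^sup>+\<omega>. (\<Prod>j<d. ennreal (F j \<omega> (vec_index w j))) \<partial>M)"
      unfolding M_def by (rule nn_integral_density[symmetric]) measurable
    also have "\<dots> = (\<integral>\<^sup>+\<omega>. ennreal (\<Prod>j<d. F j \<omega> (vec_index w j)) \<partial>M)"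
      using F_nonneg by (intro nn_integral_cong prod_ennreal) auto
    finally have eq: "(\<integral>\<^sup>+z. ennreal (?m z) \<partial>normal_law d S) = (\<integral>\<^sup>+\<omega>. ennreal (\<Prod>j<d. F j \<omega> (vec_index w j)) \<partial>M)" .
    have "rho_fun d (a, b) \<phi> e S w = enn2real (\<integral>\<^sup>+z. ennreal (?m z) \<partial>normal_law d S)"
      unfolding rho_fun_def using m_meas' m_fun_nonneg[OF \<phi>]
      by (intro integral_eq_nn_integral) (auto simp: normal_law_def)
    also have "\<dots> = (\<integral>\<omega>. (\<Prod>j<d. F j \<omega> (vec_index w j)) \<partial>M)"
      unfolding eq using F_meas F_nonneg
      by (intro integral_eq_nn_integral[symmetric]) (auto simp: M_def intro!: borel_measurable_prod prod_nonneg)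
    finally show ?thesis .
  qed
  show ?thesis
  proof (rule that[OF prob])
    show "sets M = sets ?Q" by (simp add: M_def)
  qed (use rho in \<open>simp add: F_def\<close>)
qed

section \<open>The bound on the derivatives\<close>

text \<open>
  One term of the exponential series dominates the power.
\<close>

lemma exp_minus_mult_power_le:
  fixes x :: real
  assumes "x \<ge> 0"
  shows "exp (- x) * (real v + 1 + x) ^ v \<le> fact v * exp (real v + 1)"
proof -
  have "(real v + 1 + x) ^ v \<le> fact v * exp (real v + 1 + x)"
    using power_div_fact_le_exp[of "real v + 1 + x" v] assms by (simp add: field_simps)
  then have "exp (- x) * (real v + 1 + x) ^ v \<le> exp (- x) * (fact v * exp (real v + 1 + x))"
    by (intro mult_left_mono) auto
  also have "\<dots> = fact v * exp (real v + 1)"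
    by (simp add: mult.left_commute exp_add[symmetric])
  finally show ?thesis .
qed

text \<open>
  Derivatives of order at most \<open>v\<close> admit a common constant.
\<close>

lemma interval_deriv_le_outside_mass_uniform:
  assumes K: "K \<ge> 0"
  obtains C where "C \<ge> 1" "\<And>r L h a b p q y. r < v \<Longrightarrow> L \<ge> 1 \<Longrightarrow> h > 0 \<Longrightarrow> \<bar>y\<bar> \<le> h * (K / L) \<Longrightarrow>
    \<bar>interval_deriv (Suc r) h a b (p + y) (q + y)\<bar>
      \<le> C * (L / h) ^ Suc r * (outside_mass h a b (p - h * (K / L)) (q + h * (K / L)) + exp (- L\<^sup>2))"
proof -
  have "\<exists>C\<ge>1. \<forall>L h a b p q y. L \<ge> 1 \<longrightarrow> h > 0 \<longrightarrow> \<bar>y\<bar> \<le> h * (K / L) \<longrightarrow>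
    \<bar>interval_deriv (Suc r) h a b (p + y) (q + y)\<bar>
      \<le> C * (L / h) ^ Suc r * (outside_mass h a b (p - h * (K / L)) (q + h * (K / L)) + exp (- L\<^sup>2))" for r
    by (rule interval_deriv_le_outside_mass[OF K, of r]) blast
  then obtain Cf where Cf: "\<And>r. Cf r \<ge> 1" "\<And>r L h a b p q y. L \<ge> 1 \<Longrightarrow> h > 0 \<Longrightarrow> \<bar>y\<bar> \<le> h * (K / L) \<Longrightarrow>
    \<bar>interval_deriv (Suc r) h a b (p + y) (q + y)\<bar>
      \<le> Cf r * (L / h) ^ Suc r * (outside_mass h a b (p - h * (K / L)) (q + h * (K / L)) + exp (- L\<^sup>2))"
    by metis
  define C where "C = 1 + (\<Sum>r<v. Cf r)"
  have Cf0: "0 \<le> Cf r" for r using Cf(1)[of r] by linarith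
  show ?thesis
  proof (rule that[of C])
    show "C \<ge> 1" using Cf0 by (simp add: C_def sum_nonneg)
    fix r :: nat and L h p q y :: real and a b :: ereal
    assume r: "r < v" and L: "L \<ge> 1" and h: "h > 0" and y: "\<bar>y\<bar> \<le> h * (K / L)"
    have "Cf r \<le> (\<Sum>r<v. Cf r)"
      using r Cf0 by (intro member_le_sum) auto
    then have le: "Cf r \<le> C" by (simp add: C_def)
    have "\<bar>interval_deriv (Suc r) h a b (p + y) (q + y)\<bar>
      \<le> Cf r * (L / h) ^ Suc r * (outside_mass h a b (p - h * (K / L)) (q + h * (K / L)) + exp (- L\<^sup>2))"
      by (rule Cf(2)[OF L h y])
    also have "\<dots> \<le> C * (L / h) ^ Suc r * (outside_mass h a b (p - h * (K / L)) (q + h * (K / L)) + exp (- L\<^sup>2))"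
      using le L h outside_mass_nonneg[of h a b "p - h * (K / L)" "q + h * (K / L)"]
      by (intro mult_right_mono add_nonneg_nonneg) auto
    finally show "\<bar>interval_deriv (Suc r) h a b (p + y) (q + y)\<bar>
      \<le> C * (L / h) ^ Suc r * (outside_mass h a b (p - h * (K / L)) (q + h * (K / L)) + exp (- L\<^sup>2))" .
  qed
qed

text \<open>
  The bound for any \<open>s\<close> that leaves \<open>S - s\<^sup>2 I\<close> positive definite.  The function \<open>H js\<close>
  dominates the integrand of the derivative \<open>js\<close> at all points of the box at once, so the supremum over
  the box moves inside the average, and the sum over \<open>js\<close> is carried out pointwise.
\<close>

lemma sum_SUP_partial_derivs_le:
  fixes v :: nat and K :: real
  assumes K: "K \<ge> 0"
  obtains C where "C > 0"
    "\<And>d \<phi> e s S a b w L.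
      S \<in> carrier_mat d d \<Longrightarrow> transpose_mat S = S \<Longrightarrow> positive_definite d S \<Longrightarrow>
      s > 0 \<Longrightarrow> (\<forall>z. (\<exists>i<d. z i \<noteq> 0) \<longrightarrow> s\<^sup>2 * (\<Sum>i<d. (z i)\<^sup>2) < qform d S z) \<Longrightarrow>
      \<phi> > 0 \<Longrightarrow> e > 0 \<Longrightarrow> d > 0 \<Longrightarrow> (\<forall>j<d. a j \<le> b j) \<Longrightarrow> w \<in> carrier_vec d \<Longrightarrow>
      L \<ge> 1 \<Longrightarrow> exp (- L\<^sup>2) = 1 / real d \<Longrightarrow>
      (\<Sum>js\<in>index_tuples d v. SUP y\<in>R_box d (e * s * (K / L)).
         ennreal \<bar>partial_derivs d js (rho_fun d (a, b) \<phi> e S) (w + y)\<bar>)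
       \<le> ennreal (C * (L / (e * s)) ^ v)"
proof -
  obtain C where C: "C \<ge> 1" "\<And>r L h a b p q y. r < v \<Longrightarrow> L \<ge> 1 \<Longrightarrow> h > 0 \<Longrightarrow> \<bar>y\<bar> \<le> h * (K / L) \<Longrightarrow>
    \<bar>interval_deriv (Suc r) h a b (p + y) (q + y)\<bar>
      \<le> C * (L / h) ^ Suc r * (outside_mass h a b (p - h * (K / L)) (q + h * (K / L)) + exp (- L\<^sup>2))"
    by (rule interval_deriv_le_outside_mass_uniform[OF K, of v]) blast
  define C' where "C' = (C * exp 1) ^ v * (fact v * exp (real v + 1))"
  show ?thesis
  proof (rule that[of C'])
    show "C' > 0" using C(1) by (simp add: C'_def)
    fix d :: nat and \<phi> e s L :: real and S :: "real mat" and a b :: "nat \<Rightarrow> ereal" and w :: "real vec"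
    assume S: "S \<in> carrier_mat d d" "transpose_mat S = S" "positive_definite d S"
      and s: "s > 0" and gt: "\<forall>z. (\<exists>i<d. z i \<noteq> 0) \<longrightarrow> s\<^sup>2 * (\<Sum>i<d. (z i)\<^sup>2) < qform d S z"
      and \<phi>: "\<phi> > 0" and e: "e > 0" and d: "d > 0" and ab: "\<forall>j<d. a j \<le> b j" and w: "w \<in> carrier_vec d"
      and L: "L \<ge> 1" and eL: "exp (- L\<^sup>2) = 1 / real d"
    define h where "h = e * s"
    have h: "h > 0" using e s by (simp add: h_def)
    define k where "k = h * (K / L)"
    define \<rho> where "\<rho> = rho_fun d (a, b) \<phi> e S"
    obtain M :: "((nat \<Rightarrow> real) \<times> real) measure" where M: "prob_space M"
      and setsM: "sets M = sets (Pi\<^sub>M {..<d} (\<lambda>_. lborel) \<Otimes>\<^sub>M lborel)"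
      and rho: "\<And>w. w \<in> carrier_vec d \<Longrightarrow> \<rho> w
       = (\<integral>\<omega>. (\<Prod>j<d. interval_deriv 0 (e * s) (a j) (b j)
            (e * fst \<omega> j - \<bar>snd \<omega>\<bar> / \<phi> + vec_index w j) (e * fst \<omega> j + \<bar>snd \<omega>\<bar> / \<phi> + vec_index w j)) \<partial>M)"
      unfolding \<rho>_def
      by (rule rho_fun_mixture[OF S s _ \<phi> e d, of a b]) (use gt ab in auto)
    interpret M: prob_space M by (rule M)
    define F where "F = (\<lambda>r j \<omega> t. interval_deriv r h (a j) (b j)
            (e * fst \<omega> j - \<bar>snd \<omega>\<bar> / \<phi> + t) (e * fst \<omega> j + \<bar>snd \<omega>\<bar> / \<phi> + t))"
    define \<theta> where "\<theta> = (\<lambda>\<omega> j. outside_mass h (a j) (b j)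
            (e * fst \<omega> j - \<bar>snd \<omega>\<bar> / \<phi> + vec_index w j - k) (e * fst \<omega> j + \<bar>snd \<omega>\<bar> / \<phi> + vec_index w j + k))"
    have fst_meas: "(\<lambda>\<omega>. fst \<omega> j) \<in> borel_measurable M" if "j < d" for j
    proof -
      have "(\<lambda>x. x j) \<in> borel_measurable (Pi\<^sub>M {..<d} (\<lambda>_. lborel))"
        using measurable_component_singleton[of j "{..<d}" "\<lambda>_. lborel"] that by simp
      then have "(\<lambda>\<omega>. fst \<omega> j) \<in> borel_measurable (Pi\<^sub>M {..<d} (\<lambda>_. lborel) \<Otimes>\<^sub>M (lborel :: real measure))"
        by (rule measurable_compose[OF measurable_fst])
      then show ?thesis unfolding measurable_cong_sets[OF setsM refl] .
    qed
    have snd_meas[measurable]: "snd \<in> borel_measurable M"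
    proof -
      have "snd \<in> borel_measurable (Pi\<^sub>M {..<d} (\<lambda>_. lborel) \<Otimes>\<^sub>M (lborel :: real measure))"
        using measurable_snd by simp
      then show ?thesis unfolding measurable_cong_sets[OF setsM refl] .
    qed
    have F_meas: "(\<lambda>\<omega>. F r j \<omega> t) \<in> borel_measurable M" if "j < d" for r j t
      unfolding F_def interval_deriv_def using measurable_end_deriv[OF h] fst_meas[OF that] by measurable
    have \<theta>_meas: "(\<lambda>\<omega>. \<theta> \<omega> j) \<in> borel_measurable M" if "j < d" for j
      unfolding \<theta>_def outside_mass_def using measurable_end_deriv[OF h] fst_meas[OF that] by measurable
    have "\<exists>c. \<forall>a b p q. \<bar>interval_deriv r h a b p q\<bar> \<le> c" for r
      by (rule interval_deriv_bounded[OF h, of r]) blast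
    then obtain c where c: "\<And>r a b p q. \<bar>interval_deriv r h a b p q\<bar> \<le> c r" by metis
    have pd: "partial_derivs d js \<rho> x = (\<integral>\<omega>. (\<Prod>j<d. F (count_list js j) j \<omega> (vec_index x j)) \<partial>M)"
      if "set js \<subseteq> {..<d}" "x \<in> carrier_vec d" for js x
    proof (rule partial_derivs_integral_prod[OF M.finite_measure_axioms _ _ _ _ that])
      show "(F r j \<omega> has_real_derivative F (Suc r) j \<omega> t) (at t)" for r j \<omega> t
        unfolding F_def by (rule DERIV_interval_deriv[OF h])
      show "\<bar>F r j \<omega> t\<bar> \<le> c r" for r j \<omega> t unfolding F_def by (rule c)
      show "\<rho> w = (\<integral>\<omega>. (\<Prod>j<d. F 0 j \<omega> (vec_index w j)) \<partial>M)" if "w \<in> carrier_vec d" for w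
        unfolding F_def h_def by (rule rho[OF that])
    qed (rule F_meas)
    define H where "H = (\<lambda>js \<omega>. (C * exp 1) ^ v * (L / h) ^ v * exp (- (\<Sum>j<d. \<theta> \<omega> j))
        * (\<Prod>j\<in>set js. \<theta> \<omega> j + 1 / real d))"
    have \<theta>0: "0 \<le> \<theta> \<omega> j" for \<omega> j unfolding \<theta>_def by (rule outside_mass_nonneg)
    have H_meas: "(\<lambda>\<omega>. ennreal (H js \<omega>)) \<in> borel_measurable M" if "set js \<subseteq> {..<d}" for js
      unfolding H_def using \<theta>_meas that
      by (intro measurable_compose[OF _ measurable_ennreal] borel_measurable_times borel_measurable_const
          borel_measurable_prod borel_measurable_add measurable_compose[OF _ borel_measurable_exp]
          borel_measurable_uminus borel_measurable_sum) auto
    have H_nonneg: "0 \<le> H js \<omega>" for js \<omega>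
      unfolding H_def using C(1) L h \<theta>0 by (intro mult_nonneg_nonneg prod_nonneg) auto
    have sup: "(SUP y\<in>R_box d k. ennreal \<bar>partial_derivs d js \<rho> (w + y)\<bar>) \<le> (\<integral>\<^sup>+\<omega>. ennreal (H js \<omega>) \<partial>M)"
      if js: "js \<in> index_tuples d v" for js
    proof (rule SUP_least)
      fix y assume y: "y \<in> R_box d k"
      then have yc: "y \<in> carrier_vec d" and "sup_norm d y \<le> k" by (auto simp: R_box_def)
      then have yk: "\<bar>vec_index y j\<bar> \<le> k" if "j < d" for j
        using that unfolding sup_norm_def by (subst (asm) Max_le_iff) auto
      have sub: "set js \<subseteq> {..<d}" using js by (simp add: index_tuples_def)
      let ?G = "\<lambda>\<omega> r j. F r j \<omega> (vec_index (w + y) j)"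
      have G_eq: "?G \<omega> r j = interval_deriv r h (a j) (b j)
            (e * fst \<omega> j - \<bar>snd \<omega>\<bar> / \<phi> + vec_index w j + vec_index y j)
            (e * fst \<omega> j + \<bar>snd \<omega>\<bar> / \<phi> + vec_index w j + vec_index y j)" if "j < d" for \<omega> r j
        using that w yc by (simp add: F_def add.assoc)
      have bound: "(\<Prod>j<d. \<bar>?G \<omega> (count_list js j) j\<bar>) \<le> H js \<omega>" for \<omega>
        unfolding H_def
      proof (rule prod_count_list_le[OF js \<theta>0 C(1)])
        fix j assume j: "j < d"
        show "0 \<le> ?G \<omega> 0 j"
          unfolding G_eq[OF j] using h ab j \<phi> by (intro interval_deriv_0_nonneg) auto
        show "?G \<omega> 0 j \<le> 1 - \<theta> \<omega> j"
          unfolding G_eq[OF j] \<theta>_def by (rule interval_deriv_0_le_outside_mass[OF h yk[OF j]])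
        show "\<bar>?G \<omega> (Suc r) j\<bar> \<le> C * (L / h) ^ Suc r * (\<theta> \<omega> j + 1 / real d)" if "r < v" for r
          unfolding G_eq[OF j] \<theta>_def k_def eL[symmetric]
          by (rule C(2)[OF that L h yk[OF j, unfolded k_def]])
      qed (use L h in auto)
      have "ennreal \<bar>partial_derivs d js \<rho> (w + y)\<bar> = ennreal (norm (\<integral>\<omega>. (\<Prod>j<d. ?G \<omega> (count_list js j) j) \<partial>M))"
        using w yc by (subst pd[OF sub]) auto
      also have "\<dots> \<le> (\<integral>\<^sup>+\<omega>. ennreal (norm (\<Prod>j<d. ?G \<omega> (count_list js j) j)) \<partial>M)"
      proof (rule integral_norm_bound_ennreal)
        show "integrable M (\<lambda>\<omega>. \<Prod>j<d. ?G \<omega> (count_list js j) j)"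
        proof (rule M.integrable_const_bound[where B = "\<Prod>j<d. c (count_list js j)"])
          show "AE \<omega> in M. norm (\<Prod>j<d. ?G \<omega> (count_list js j) j) \<le> (\<Prod>j<d. c (count_list js j))"
            unfolding real_norm_def abs_prod F_def by (intro AE_I2 prod_mono) (auto intro: c)
          show "(\<lambda>\<omega>. \<Prod>j<d. ?G \<omega> (count_list js j) j) \<in> borel_measurable M"
            by (intro borel_measurable_prod F_meas) auto
        qed
      qed
      also have "\<dots> \<le> (\<integral>\<^sup>+\<omega>. ennreal (H js \<omega>) \<partial>M)"
        unfolding real_norm_def abs_prod by (intro nn_integral_mono ennreal_leI bound)
      finally show "ennreal \<bar>partial_derivs d js \<rho> (w + y)\<bar> \<le> (\<integral>\<^sup>+\<omega>. ennreal (H js \<omega>) \<partial>M)" .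
    qed
    have total: "(\<Sum>js\<in>index_tuples d v. H js \<omega>) \<le> C' * (L / h) ^ v" for \<omega>
    proof -
      let ?T = "\<Sum>j<d. \<theta> \<omega> j"
      have T: "?T \<ge> 0" using \<theta>0 by (intro sum_nonneg) auto
      have "(\<Sum>js\<in>index_tuples d v. H js \<omega>)
          = (C * exp 1) ^ v * (L / h) ^ v * exp (- ?T) * (\<Sum>js\<in>index_tuples d v. \<Prod>j\<in>set js. \<theta> \<omega> j + 1 / real d)"
        unfolding H_def by (simp add: sum_distrib_left)
      also have "\<dots> \<le> (C * exp 1) ^ v * (L / h) ^ v * exp (- ?T) * (real v + (\<Sum>j<d. \<theta> \<omega> j + 1 / real d)) ^ v"
        using C(1) L h \<theta>0 by (intro mult_left_mono sum_index_tuples_prod_set_le) auto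
      also have "real v + (\<Sum>j<d. \<theta> \<omega> j + 1 / real d) = real v + 1 + ?T"
        using d by (simp add: sum.distrib)
      also have "(C * exp 1) ^ v * (L / h) ^ v * exp (- ?T) * (real v + 1 + ?T) ^ v
          = (C * exp 1) ^ v * (L / h) ^ v * (exp (- ?T) * (real v + 1 + ?T) ^ v)"
        by (simp only: mult.assoc)
      also have "\<dots> \<le> (C * exp 1) ^ v * (L / h) ^ v * (fact v * exp (real v + 1))"
        using C(1) L h by (intro mult_left_mono exp_minus_mult_power_le T) auto
      finally show ?thesis unfolding C'_def by (simp only: mult_ac)
    qed
    have "(\<Sum>js\<in>index_tuples d v. SUP y\<in>R_box d k. ennreal \<bar>partial_derivs d js \<rho> (w + y)\<bar>)
        \<le> (\<Sum>js\<in>index_tuples d v. \<integral>\<^sup>+\<omega>. ennreal (H js \<omega>) \<partial>M)"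
      by (rule sum_mono[OF sup])
    also have "\<dots> = (\<integral>\<^sup>+\<omega>. (\<Sum>js\<in>index_tuples d v. ennreal (H js \<omega>)) \<partial>M)"
      by (rule nn_integral_sum[symmetric]) (auto intro!: H_meas simp: index_tuples_def)
    also have "\<dots> \<le> (\<integral>\<^sup>+\<omega>. ennreal (C' * (L / h) ^ v) \<partial>M)"
      using total H_nonneg by (intro nn_integral_mono) (simp add: sum_ennreal ennreal_leI)
    also have "\<dots> = ennreal (C' * (L / h) ^ v)"
      by (simp add: M.emeasure_space_1)
    finally show "(\<Sum>js\<in>index_tuples d v. SUP y\<in>R_box d (e * s * (K / L)).
         ennreal \<bar>partial_derivs d js (rho_fun d (a, b) \<phi> e S) (w + y)\<bar>) \<le> ennreal (C' * (L / (e * s)) ^ v)"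
      unfolding k_def h_def \<rho>_def .
  qed
qed

theorem lemma6p2:
  fixes v :: nat and K :: real
  assumes "v \<ge> 1" and "K > 0"
  shows "\<exists>C::real. C > 0 \<and>
    (\<forall>(d::nat) (\<phi>::real) (\<epsilon>::real) (S::real mat).
      d \<ge> 3 \<and> \<phi> > 0 \<and> 0 < \<epsilon> \<and> \<epsilon> \<le> 1 \<and>
      S \<in> carrier_mat d d \<and> transpose_mat S = S \<and> positive_definite d S \<and>
      (\<forall>j<d. S $$ (j, j) = 1) \<longrightarrow>
      (let \<eta> = K / sqrt (ln (real d)); \<sigma> = sigma_star S in
        (SUP A \<in> rectangles d. SUP w \<in> carrier_vec d.
           \<Sum>js \<in> index_tuples d v. SUP y \<in> R_box d (\<epsilon> * \<sigma> * \<eta>).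
             ennreal \<bar>partial_derivs d js (rho_fun d A \<phi> \<epsilon> S) (w + y)\<bar>)
        \<le> ennreal (C * (ln (real d) powr (real v / 2)) / (\<epsilon> * \<sigma>) ^ v)))"
proof -
  \<comment> \<open>halving \<open>sigma_star\<close> below is compensated by \<open>2 * K\<close> here, which keeps the radius of the box\<close>
  have "2 * K \<ge> 0" using assms(2) by simp
  from sum_SUP_partial_derivs_le[OF this, of v]
  obtain C where C: "C > 0" and bound:
    "\<And>d \<phi> e s S a b w L.
      S \<in> carrier_mat d d \<Longrightarrow> transpose_mat S = S \<Longrightarrow> positive_definite d S \<Longrightarrow>
      s > 0 \<Longrightarrow> (\<forall>z. (\<exists>i<d. z i \<noteq> 0) \<longrightarrow> s\<^sup>2 * (\<Sum>i<d. (z i)\<^sup>2) < qform d S z) \<Longrightarrow>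
      \<phi> > 0 \<Longrightarrow> e > 0 \<Longrightarrow> d > 0 \<Longrightarrow> (\<forall>j<d. a j \<le> b j) \<Longrightarrow> w \<in> carrier_vec d \<Longrightarrow>
      L \<ge> 1 \<Longrightarrow> exp (- L\<^sup>2) = 1 / real d \<Longrightarrow>
      (\<Sum>js\<in>index_tuples d v. SUP y\<in>R_box d (e * s * (2 * K / L)).
         ennreal \<bar>partial_derivs d js (rho_fun d (a, b) \<phi> e S) (w + y)\<bar>)
       \<le> ennreal (C * (L / (e * s)) ^ v)"
    by blast
  show ?thesis
  proof (intro exI[of _ "C * 2 ^ v"] conjI allI impI)
    show "C * 2 ^ v > 0" using C by simp
    fix d :: nat and \<phi> \<epsilon> :: real and S :: "real mat"
    assume asm: "d \<ge> 3 \<and> \<phi> > 0 \<and> 0 < \<epsilon> \<and> \<epsilon> \<le> 1 \<and>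
      S \<in> carrier_mat d d \<and> transpose_mat S = S \<and> positive_definite d S \<and> (\<forall>j<d. S $$ (j, j) = 1)"
    then have d: "d \<ge> 3" "d > 0" and \<phi>: "\<phi> > 0" and \<epsilon>: "\<epsilon> > 0"
      and S: "S \<in> carrier_mat d d" "transpose_mat S = S" "positive_definite d S" by auto
    define \<sigma> where "\<sigma> = sigma_star S"
    have \<sigma>: "\<sigma> > 0" and ge: "\<And>z. \<sigma>\<^sup>2 * (\<Sum>i<d. (z i)\<^sup>2) \<le> qform d S z"
      using sigma_star_positive_definite[OF S(1,2) d(2) S(3)] by (auto simp: \<sigma>_def)
    define L where "L = sqrt (ln (real d))"
    have ln1: "1 \<le> ln (real d)"
    proof -
      have "exp 1 \<le> (3 :: real)" by (rule exp_le)
      also have "\<dots> \<le> real d" using d by simp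
      finally show ?thesis using d by (subst ln_ge_iff) auto
    qed
    then have L: "L \<ge> 1" "L\<^sup>2 = ln (real d)" by (auto simp: L_def)
    have eL: "exp (- L\<^sup>2) = 1 / real d"
      using d by (simp add: L(2) exp_minus inverse_eq_divide)
    \<comment> \<open>any factor below 1 would do; it makes the inequality strict, so that the law of the centres has a density\<close>
    have gt: "\<forall>z. (\<exists>i<d. z i \<noteq> 0) \<longrightarrow> (\<sigma> / 2)\<^sup>2 * (\<Sum>i<d. (z i)\<^sup>2) < qform d S z"
    proof (intro allI impI)
      fix z :: "nat \<Rightarrow> real"
      assume "\<exists>i<d. z i \<noteq> 0"
      then have "(\<Sum>i<d. (z i)\<^sup>2) > 0"
        by (metis (no_types, lifting) finite_lessThan lessThan_iff sum_pos2 zero_le_power2 zero_less_power2)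
      then have "(\<sigma> / 2)\<^sup>2 * (\<Sum>i<d. (z i)\<^sup>2) < \<sigma>\<^sup>2 * (\<Sum>i<d. (z i)\<^sup>2)"
        using \<sigma> by (intro mult_strict_right_mono) (auto simp: power_divide)
      with ge show "(\<sigma> / 2)\<^sup>2 * (\<Sum>i<d. (z i)\<^sup>2) < qform d S z" by (meson less_le_trans)
    qed
    have rad: "\<epsilon> * (\<sigma> / 2) * (2 * K / L) = \<epsilon> * \<sigma> * (K / L)" by simp
    have const: "C * (L / (\<epsilon> * (\<sigma> / 2))) ^ v = C * 2 ^ v * (ln (real d) powr (real v / 2)) / (\<epsilon> * \<sigma>) ^ v"
    proof -
      have "L ^ v = L powr real v" using L by (simp add: powr_realpow)
      also have "\<dots> = ln (real d) powr (real v / 2)"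
        using ln1 by (simp add: L_def powr_half_sqrt[symmetric] powr_powr)
      finally have Lv: "L ^ v = ln (real d) powr (real v / 2)" .
      have "L / (\<epsilon> * (\<sigma> / 2)) = 2 * L / (\<epsilon> * \<sigma>)" by simp
      then show ?thesis by (simp add: power_divide power_mult_distrib Lv[symmetric])
    qed
    have "(SUP A \<in> rectangles d. SUP w \<in> carrier_vec d.
           \<Sum>js \<in> index_tuples d v. SUP y \<in> R_box d (\<epsilon> * \<sigma> * (K / L)).
             ennreal \<bar>partial_derivs d js (rho_fun d A \<phi> \<epsilon> S) (w + y)\<bar>)
        \<le> ennreal (C * 2 ^ v * (ln (real d) powr (real v / 2)) / (\<epsilon> * \<sigma>) ^ v)"
    proof (intro SUP_least)
      fix A :: "(nat \<Rightarrow> ereal) \<times> (nat \<Rightarrow> ereal)" and w :: "real vec"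
      assume A: "A \<in> rectangles d" and w: "w \<in> carrier_vec d"
      obtain a b where Ab: "A = (a, b)" by (cases A)
      have ab: "\<forall>j<d. a j \<le> b j" using A by (simp add: Ab rectangles_def)
      show "(\<Sum>js \<in> index_tuples d v. SUP y \<in> R_box d (\<epsilon> * \<sigma> * (K / L)).
             ennreal \<bar>partial_derivs d js (rho_fun d A \<phi> \<epsilon> S) (w + y)\<bar>)
        \<le> ennreal (C * 2 ^ v * (ln (real d) powr (real v / 2)) / (\<epsilon> * \<sigma>) ^ v)"
        using bound[OF S _ gt \<phi> \<epsilon> d(2) ab w L(1) eL] \<sigma> unfolding rad const Ab by simp
    qed
    then show "let \<eta> = K / sqrt (ln (real d)); \<sigma> = sigma_star S in
        (SUP A \<in> rectangles d. SUP w \<in> carrier_vec d.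
           \<Sum>js \<in> index_tuples d v. SUP y \<in> R_box d (\<epsilon> * \<sigma> * \<eta>).
             ennreal \<bar>partial_derivs d js (rho_fun d A \<phi> \<epsilon> S) (w + y)\<bar>)
        \<le> ennreal (C * 2 ^ v * (ln (real d) powr (real v / 2)) / (\<epsilon> * \<sigma>) ^ v)"
      by (simp add: Let_def \<sigma>_def L_def)
  qed
qed

end
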